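(* Let $\mu_{\boldsymbol\theta}=\mathcal N(m,\sigma^2)$ for $\boldsymbol\theta=(m,\sigma)\in\mathbb R\times(0,\infty)$, with base measure $\mu_b=\delta_0$ (the Dirac measure at $0$, corresponding to $m=\sigma=0$). Then the bivariate $\mathrm{WCP}_2$ prior of $(m,\sigma)$ with hyperparameter $\eta>0$ has density $$\pi(m,\sigma)=\frac{\eta\exp\bigl(-\eta(m^2+\sigma^2)^{1/2}\bigr)}{\pi\,(m^2+\sigma^2)^{1/2}},\qquad (m,\sigma)\in\mathbb R\times(0,\infty),$$ where $\pi$ in the denominator on the right-hand side is the number $\pi$.
   Context: $W_2$ is the Wasserstein-2 distance between probability measures on $\mathbb R$: $W_2(\mu,\nu)^2=\inf$ over couplings $(X,Y)$ of $\mu$ and $\nu$ of $\mathbb E|X-Y|^2$. Multivariate $\mathrm{WCP}_p$ prior. Let $\boldsymbol\Theta\subset\mathbb R^d$ be the parameter set, $\overline{\boldsymbol\Theta}$ its closure in $[-\infty,\infty]^d$, $\mu_b$ the base measure, $W_p(\boldsymbol\theta)=W_p(\mu_b,\mu_{\boldsymbol\theta})$ (extended by continuity to $\overline{\boldsymbol\Theta}$), $c=\sup_{\boldsymbol\theta\in\boldsymbol\Theta}W_p(\boldsymbol\theta)\in(0,\infty]$, and $S_{w,\boldsymbol\theta}=\{\boldsymbol\theta\in\overline{\boldsymbol\Theta}:W_p(\boldsymbol\theta)=w\}$. Assume $W_p(\cdot)$ is $C^1$ on $\boldsymbol\Theta$ and continuous on $\overline{\boldsymbol\Theta}$, has nonvanishing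 gradient away from base parameters, and every nonempty $S_{w,\boldsymbol\theta}$ is compact. The $\mathrm{WCP}_p$ prior with hyperparameter $\eta>0$ is the law of $\boldsymbol\theta$ for which $w=W_p(\boldsymbol\theta)$ has an exponential distribution with rate $\eta$ truncated to $(0,c)$ and, given $w$, $\boldsymbol\theta$ is uniformly distributed on $S_{w,\boldsymbol\theta}$ with respect to $(d-1)$-dimensional surface area. Explicitly: if for every $w>0$ with $S_{w,\boldsymbol\theta}\ne\emptyset$ there is a parameterization $X_w:U_w\subset\mathbb R^{d-1}\to\widetilde S_{w,\boldsymbol\theta}\subset S_{w,\boldsymbol\theta}$ with $\mathrm{Area}_{d-1}(S_{w,\boldsymbol\theta}\setminus\widetilde S_{w,\boldsymbol\theta})=0$, and $(w,\boldsymbol u)\mapsto X_w(\boldsymbol u)$ is a local diffeomorphism, its density is $$\pi(\boldsymbol\theta)=|\det J_{\boldsymbol\Phi}(\boldsymbol\theta)|\,\frac{\eta\exp(-\eta W_p(\boldsymbol\theta))}{1-\exp(-\eta c)}\,\frac{\sqrt{\det\boldsymbol G(\boldsymbol\theta)}}{\mathrm{Area}_{d-1}(S_{W_p(\boldsymbol\theta),\boldsymbol\theta})},$$ where $\boldsymbol\Phi(\boldsymbol\theta)=(W_p(\boldsymbol\theta),X_{W_p(\boldsymbol\theta)}^{-1}(\boldsymbol\theta))$, $J$ denotes Jacobian matrix, $\boldsymbol G(\boldsymbol\theta)=J_{X_w}(\boldsymbol u)^\top J_{X_w}(\boldsymbol u)$ evaluated at $w=W_p(\boldsymbol\theta)$,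 $\boldsymbol u=X_{W_p(\boldsymbol\theta)}^{-1}(\boldsymbol\theta)$, and $\exp(-\infty)=0$. Here $d=2$, $p=2$. *)

theory Defs
  imports "HOL-Probability.Probability"
begin

definition coupling :: "real measure \<Rightarrow> real measure \<Rightarrow> (real \<times> real) measure \<Rightarrow> bool" where
  "coupling \<mu> \<nu> M \<longleftrightarrow> prob_space M \<and> sets M = sets (borel \<Otimes>\<^sub>M borel)
     \<and> distr M borel fst = \<mu> \<and> distr M borel snd = \<nu>"

text \<open>The transport cost may be infinite, so the distance takes values in \<open>[0, \<infinity>]\<close>.\<close>

definition wasserstein2 :: "real measure \<Rightarrow> real measure \<Rightarrow> ennreal" where
  "wasserstein2 \<mu> \<nu> =
     (let I = (INF M \<in> {M. coupling \<mu> \<nu> M}. \<integral>\<^sup>+ z. ennreal (\<bar>fst z - snd z\<bar>\<^sup>2) \<partial>M)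
      in if I = \<infinity> then \<infinity> else ennreal (sqrt (enn2real I)))"

text \<open>
  The \<open>s\<close>-dimensional Hausdorff (outer) measure. The factor makes it agree with
  \<open>s\<close>-dimensional surface area on smooth \<open>s\<close>-dimensional surfaces (for \<open>s = 1\<close>: length).
  The empty set is treated separately because \<open>0 ^ 0 = 1\<close>; covers are by bounded sets
  because \<open>diameter\<close> is unspecified on unbounded ones.
\<close>

definition hausdorff_gauge :: "nat \<Rightarrow> 'a::metric_space set \<Rightarrow> ennreal" where
  "hausdorff_gauge s E =
     (if E = {} then 0 else ennreal (unit_ball_vol (real s) * (diameter E / 2) ^ s))"

definition hausdorff_measure :: "nat \<Rightarrow> 'a::metric_space set \<Rightarrow> ennreal" where
  "hausdorff_measure s A =
     (SUP \<delta> \<in> {0::real<..}.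
        INF C \<in> {C :: nat \<Rightarrow> 'a set. A \<subseteq> (\<Union>i. C i) \<and> (\<forall>i. bounded (C i) \<and> diameter (C i) \<le> \<delta>)}.
          \<Sum>i. hausdorff_gauge s (C i))"

definition surface_area :: "(real ^ 'd::finite) set \<Rightarrow> ennreal" where
  "surface_area A = hausdorff_measure (CARD('d) - 1) A"

definition embed :: "real ^ 'd \<Rightarrow> ereal ^ 'd" where
  "embed \<theta> = (\<chi> i. ereal (\<theta> $ i))"

definition ext_closure :: "(real ^ 'd::finite) set \<Rightarrow> (ereal ^ 'd) set" where
  "ext_closure \<Theta> = closure (embed ` \<Theta>)"

text \<open>
  In the following, \<open>\<Theta>\<close> is the parameter set, \<open>\<mu>b\<close> the base measure and \<open>\<mu>\<close> the
  parametrised family.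
\<close>

definition W2 :: "real measure \<Rightarrow> (real ^ 'd \<Rightarrow> real measure) \<Rightarrow> real ^ 'd \<Rightarrow> ennreal" where
  "W2 \<mu>b \<mu> \<theta> = wasserstein2 \<mu>b (\<mu> \<theta>)"

text \<open>The filter of parameters \<open>\<theta> \<in> \<Theta>\<close> tending to the point \<open>x\<close> of \<open>[-\<infinity>, \<infinity>]\<close>\<open>\<^sup>d\<close>.\<close>

definition param_filter :: "(real ^ 'd::finite) set \<Rightarrow> ereal ^ 'd \<Rightarrow> (real ^ 'd) filter" where
  "param_filter \<Theta> x = inf (filtercomap embed (nhds x)) (principal \<Theta>)"

definition W2_ext ::
  "(real ^ 'd::finite) set \<Rightarrow> real measure \<Rightarrow> (real ^ 'd \<Rightarrow> real measure) \<Rightarrow> ereal ^ 'd \<Rightarrow> ennreal" where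
  "W2_ext \<Theta> \<mu>b \<mu> x = Lim (param_filter \<Theta> x) (W2 \<mu>b \<mu>)"

definition W2_sup ::
  "(real ^ 'd) set \<Rightarrow> real measure \<Rightarrow> (real ^ 'd \<Rightarrow> real measure) \<Rightarrow> ennreal" where
  "W2_sup \<Theta> \<mu>b \<mu> = (SUP \<theta>\<in>\<Theta>. W2 \<mu>b \<mu> \<theta>)"

definition level_set ::
  "(real ^ 'd::finite) set \<Rightarrow> real measure \<Rightarrow> (real ^ 'd \<Rightarrow> real measure) \<Rightarrow> ennreal \<Rightarrow> (ereal ^ 'd) set" where
  "level_set \<Theta> \<mu>b \<mu> w = {x \<in> ext_closure \<Theta>. W2_ext \<Theta> \<mu>b \<mu> x = w}"

text \<open>
  The standing assumptions under which the prior is defined. Surface area refers to subsets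
  of \<open>\<real>\<close>\<open>\<^sup>d\<close>, hence the last clause: the level sets that carry the prior contain no infinite
  points. Together with compactness it says that they are compact in \<open>\<real>\<close>\<open>\<^sup>d\<close>.
\<close>

definition wcp2_admissible ::
  "(real ^ 'd::finite) set \<Rightarrow> real measure \<Rightarrow> (real ^ 'd \<Rightarrow> real measure) \<Rightarrow> bool" where
  "wcp2_admissible \<Theta> \<mu>b \<mu> \<longleftrightarrow>
     W2_sup \<Theta> \<mu>b \<mu> > 0 \<and>
     (\<forall>\<theta>\<in>\<Theta>. W2 \<mu>b \<mu> \<theta> \<noteq> \<infinity>) \<and>
     (\<exists>g :: real ^ 'd \<Rightarrow> real ^ 'd. continuous_on \<Theta> g \<and>
        (\<forall>\<theta>\<in>\<Theta>. ((\<lambda>t. enn2real (W2 \<mu>b \<mu> t)) has_derivative (\<lambda>h. g \<theta> \<bullet> h)) (at \<theta> within \<Theta>)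
           \<and> (\<mu> \<theta> \<noteq> \<mu>b \<longrightarrow> g \<theta> \<noteq> 0))) \<and>
     (\<forall>x\<in>ext_closure \<Theta>. (W2 \<mu>b \<mu> \<longlongrightarrow> W2_ext \<Theta> \<mu>b \<mu> x) (param_filter \<Theta> x)) \<and>
     continuous_on (ext_closure \<Theta>) (W2_ext \<Theta> \<mu>b \<mu>) \<and>
     (\<forall>w. level_set \<Theta> \<mu>b \<mu> w \<noteq> {} \<longrightarrow> compact (level_set \<Theta> \<mu>b \<mu> w)) \<and>
     (\<forall>w. 0 < w \<and> w < W2_sup \<Theta> \<mu>b \<mu> \<longrightarrow> level_set \<Theta> \<mu>b \<mu> w \<subseteq> range embed)"

text \<open>The exponential distribution with rate \<open>\<eta>\<close> truncated to \<open>(0, c)\<close>, where \<open>c \<in> (0, \<infinity>]\<close>.\<close>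

definition trunc_exponential :: "real \<Rightarrow> ennreal \<Rightarrow> real measure" where
  "trunc_exponential \<eta> c = density lborel (\<lambda>w.
     if 0 < w \<and> ennreal w < c
     then ennreal (\<eta> * exp (- \<eta> * w) / (1 - (if c = \<infinity> then 0 else exp (- \<eta> * enn2real c))))
     else 0)"

text \<open>The probability of \<open>A\<close> under the uniform distribution on \<open>S\<close> with respect to surface area.\<close>

definition uniform_surface :: "(real ^ 'd::finite) set \<Rightarrow> (real ^ 'd) set \<Rightarrow> ennreal" where
  "uniform_surface S A = surface_area (S \<inter> A) / surface_area S"

text \<open>
  \<open>P\<close> is the law of \<open>\<theta>\<close>. The last two clauses say that \<open>w = W2 \<theta>\<close> has the truncated exponential
  distribution, and that the uniform distributions on the level sets form a conditional
  distribution of \<open>\<theta>\<close> given \<open>w\<close>.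
\<close>

definition wcp2_prior ::
  "(real ^ 'd::finite) set \<Rightarrow> real measure \<Rightarrow> (real ^ 'd \<Rightarrow> real measure) \<Rightarrow> real
     \<Rightarrow> (real ^ 'd) measure \<Rightarrow> bool" where
  "wcp2_prior \<Theta> \<mu>b \<mu> \<eta> P \<longleftrightarrow>
     wcp2_admissible \<Theta> \<mu>b \<mu> \<and>
     prob_space P \<and> sets P = sets borel \<and>
     (\<forall>B \<in> sets borel.
        emeasure P {\<theta>. embed \<theta> \<in> ext_closure \<Theta> \<and> W2_ext \<Theta> \<mu>b \<mu> (embed \<theta>) \<in> B}
        = emeasure (trunc_exponential \<eta> (W2_sup \<Theta> \<mu>b \<mu>)) {w. ennreal w \<in> B}) \<and>
     (\<forall>A \<in> sets borel. \<forall>B \<in> sets borel.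
        emeasure P {\<theta> \<in> A. embed \<theta> \<in> ext_closure \<Theta> \<and> W2_ext \<Theta> \<mu>b \<mu> (embed \<theta>) \<in> B}
        = (\<integral>\<^sup>+ w. uniform_surface (embed -` level_set \<Theta> \<mu>b \<mu> (ennreal w)) A * indicator B (ennreal w)
             \<partial>trunc_exponential \<eta> (W2_sup \<Theta> \<mu>b \<mu>)))"

text \<open>A parameter \<open>\<theta> :: real ^ 2\<close> stands for \<open>(m, \<sigma>) = (\<theta> $ 1, \<theta> $ 2)\<close>.\<close>

definition gaussian_params :: "(real ^ 2) set" where
  "gaussian_params = {\<theta>. \<theta> $ 2 > 0}"

definition gaussian :: "real ^ 2 \<Rightarrow> real measure" where
  "gaussian \<theta> = density lborel (\<lambda>x. ennreal (normal_density (\<theta> $ 1) (\<theta> $ 2) x))"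

end

theory Submission
  imports Defs
begin

text \<open>
  Every coupling of \<open>\<delta>\<^sub>0\<close> with \<open>\<nu>\<close> has cost \<open>\<integral> y\<^sup>2 d\<nu>\<close>, so the Wasserstein distance from \<open>\<delta>\<^sub>0\<close> to
  \<open>N(m, \<sigma>\<^sup>2)\<close> is the Euclidean norm of \<open>(m, \<sigma>)\<close>; it extends continuously by \<open>\<infinity>\<close> to the infinite
  points of the closure. The level sets are therefore upper half circles, on which one-dimensional
  Hausdorff measure is arc length: a curve parametrised with speed \<open>r\<close> is \<open>r\<close>-Lipschitz (upper bound),
  and chords of small length are nearly as long as their arcs (lower bound). In polar coordinates
  \<open>(r, t)\<close> the prior thus makes \<open>r\<close> exponential and \<open>t\<close> uniform on \<open>(0, \<pi>)\<close>, independently of \<open>r\<close>, and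
  the change of variables contributes the factor \<open>1 / r\<close>.
\<close>

section \<open>Polar coordinates\<close>

text \<open>\<open>has_measure_differentiable_image\<close> equates finite measure of the image with
  convergence of the Jacobian integral. One direction settles the case of a finite integral. The
  other excludes a finite image when the integral diverges, so then both sides are infinite.\<close>

lemma emeasure_differentiable_image:
  fixes g :: "real ^ 'n::{finite,wellorder} \<Rightarrow> real ^ 'n::_"
  assumes S: "S \<in> sets borel" and gS: "g ` S \<in> sets borel"
    and der: "\<And>x. x \<in> S \<Longrightarrow> (g has_derivative g' x) (at x within S)"
    and inj: "inj_on g S"
    and J: "(\<lambda>x. \<bar>det (matrix (g' x))\<bar>) \<in> borel_measurable borel"
  shows "emeasure lborel (g ` S) = (\<integral>\<^sup>+x\<in>S. ennreal \<bar>det (matrix (g' x))\<bar> \<partial>lborel)" (is "_ = ?I")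
proof (cases "?I < \<infinity>")
  case True
  have eq: "?I = (\<integral>\<^sup>+x. ennreal (indicator S x * \<bar>det (matrix (g' x))\<bar>) \<partial>lborel)"
    by (intro nn_integral_cong) (auto simp: indicator_def)
  define r where "r = enn2real ?I"
  have r: "?I = ennreal r" "r \<ge> 0" using True by (simp_all add: r_def)
  have m: "(\<lambda>x. indicator S x * \<bar>det (matrix (g' x))\<bar>) \<in> borel_measurable borel"
    using S J by measurable
  have "((\<lambda>x. indicator S x * \<bar>det (matrix (g' x))\<bar>) has_integral r) UNIV"
    by (rule nn_integral_has_integral[OF m]) (use r eq in auto)
  moreover have "(\<lambda>x. indicator S x * \<bar>det (matrix (g' x))\<bar>)
      = (\<lambda>x. if x \<in> S then \<bar>det (matrix (g' x))\<bar> else 0)"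
    by (auto simp: indicator_def)
  ultimately have "((\<lambda>x. \<bar>det (matrix (g' x))\<bar>) has_integral r) S"
    by (simp add: has_integral_restrict_UNIV)
  then have "g ` S \<in> lmeasurable" "measure lebesgue (g ` S) = r"
    using has_measure_differentiable_image[OF _ der inj] S by auto
  then have "emeasure lebesgue (g ` S) = ennreal r"
    by (simp add: emeasure_eq_measure2 fmeasurableD2 emeasure_eq_ennreal_measure)
  then show ?thesis using r gS by simp
next
  case False
  show ?thesis
  proof (cases "emeasure lborel (g ` S) < \<infinity>")
    case True
    then have "g ` S \<in> lmeasurable" using gS by (intro fmeasurableI) auto
    then have "((\<lambda>x. \<bar>det (matrix (g' x))\<bar>) has_integral measure lebesgue (g ` S)) S"
      using has_measure_differentiable_image[OF _ der inj] S by auto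
    from nn_integral_has_integral_lebesgue'[OF _ this] have "?I < \<infinity>" by simp
    with False show ?thesis by simp
  next
    case False': False
    with False show ?thesis by (metis infinity_ennreal_def less_top)
  qed
qed

text \<open>Lebesgue measure on the image is the pushforward of the Jacobian density on
  \<open>S\<close>: on a Borel set \<open>A\<close> this is the preceding lemma for
  \<open>S \<inter> g -\<close> A\<open>, whose image is\<close>g \<open>S \<inter> A\<close>.
  Integrating \<open>f\<close> against both measures gives the formula. Borel images are a
  hypothesis, to be met by an explicit inverse.\<close>

lemma nn_integral_change_of_variables:
  fixes g :: "real ^ 'n::{finite,wellorder} \<Rightarrow> real ^ 'n::_" and f :: "real ^ 'n::_ \<Rightarrow> ennreal"
  assumes S[measurable]: "S \<in> sets borel"
    and image: "\<And>T. T \<in> sets borel \<Longrightarrow> T \<subseteq> S \<Longrightarrow> g ` T \<in> sets borel"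
    and g[measurable]: "g \<in> borel_measurable borel"
    and der: "\<And>x. x \<in> S \<Longrightarrow> (g has_derivative g' x) (at x within S)"
    and inj: "inj_on g S"
    and J[measurable]: "(\<lambda>x. \<bar>det (matrix (g' x))\<bar>) \<in> borel_measurable borel"
    and f[measurable]: "f \<in> borel_measurable borel"
  shows "(\<integral>\<^sup>+y\<in>g ` S. f y \<partial>lborel) = (\<integral>\<^sup>+x\<in>S. ennreal \<bar>det (matrix (g' x))\<bar> * f (g x) \<partial>lborel)"
proof -
  have gS[measurable]: "g ` S \<in> sets borel" using image S by auto
  let ?D = "\<lambda>x. ennreal \<bar>det (matrix (g' x))\<bar> * indicator S x"
  have "density lborel (indicator (g ` S)) = distr (density lborel ?D) borel g"
  proof (rule measure_eqI)
    fix A assume "A \<in> sets (density lborel (indicator (g ` S)))"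
    then have A[measurable]: "A \<in> sets borel" by simp
    let ?T = "S \<inter> g -` A"
    have T: "?T \<in> sets borel" using measurable_sets[OF g A] by auto
    have im: "g ` ?T = g ` S \<inter> A" by auto
    have "emeasure (density lborel (indicator (g ` S))) A = emeasure lborel (g ` ?T)"
      by (subst emeasure_density) (auto simp: im simp flip: indicator_inter_arith)
    also have "\<dots> = (\<integral>\<^sup>+x\<in>?T. ennreal \<bar>det (matrix (g' x))\<bar> \<partial>lborel)"
      by (rule emeasure_differentiable_image[OF T])
        (use T image in \<open>auto intro!: has_derivative_subset[OF der] inj_on_subset[OF inj]\<close>)
    also have "\<dots> = (\<integral>\<^sup>+x. ?D x * indicator (g -` A) x \<partial>lborel)"
      by (auto simp: indicator_def intro!: nn_integral_cong)
    also have "\<dots> = emeasure (density lborel ?D) (g -` A)"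
      using measurable_sets[OF g A] by (subst emeasure_density) auto
    also have "\<dots> = emeasure (distr (density lborel ?D) borel g) A"
      by (subst emeasure_distr) (auto)
    finally show "emeasure (density lborel (indicator (g ` S))) A = \<dots>" .
  qed simp
  then have "(\<integral>\<^sup>+y. f y \<partial>density lborel (indicator (g ` S)))
      = (\<integral>\<^sup>+y. f y \<partial>distr (density lborel ?D) borel g)" by simp
  also have "\<dots> = (\<integral>\<^sup>+x. ?D x * f (g x) \<partial>lborel)"
    by (simp add: nn_integral_distr nn_integral_density)
  finally show ?thesis
    by (simp add: nn_integral_density mult_ac)
qed

section \<open>Coordinates of the plane\<close>

lemma borel_measurable_vec_nth [measurable]: "(\<lambda>x :: real ^ 'n. x $ i) \<in> borel_measurable borel"
  by (intro borel_measurable_continuous_onI continuous_intros)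

lemma vector_2_eq: "(vector [x $ 1, x $ 2] :: 'a::zero ^ 2) = x"
  by (simp add: vec_eq_iff forall_2)

lemma continuous_on_vector_2 [continuous_intros]:
  fixes f g :: "'a::topological_space \<Rightarrow> 'b::{zero,topological_space}"
  assumes "continuous_on S f" "continuous_on S g"
  shows "continuous_on S (\<lambda>x. vector [f x, g x] :: 'b ^ 2)"
proof -
  have eq: "(\<lambda>x. vector [f x, g x] :: 'b ^ 2) = (\<lambda>x. \<chi> i. if i = 1 then f x else g x)"
    by (auto simp: vec_eq_iff forall_2)
  show ?thesis unfolding eq
  proof (rule continuous_on_vec_lambda)
    show "continuous_on S (\<lambda>x. if i = 1 then f x else g x)" for i :: 2
      using assms by (cases "i = 1") auto
  qed
qed

lemma measurable_vector_2 [measurable]: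
  "(\<lambda>(a, b). vector [a, b] :: real ^ 2) \<in> borel \<Otimes>\<^sub>M borel \<rightarrow>\<^sub>M borel"
  unfolding borel_prod by (intro borel_measurable_continuous_onI) (auto intro!: continuous_intros simp: case_prod_beta)

text \<open>Lebesgue measure is determined by its values on boxes, and a box pulls back to a
  rectangle. This makes Fubini available for integrals over \<open>real ^ 2\<close>.\<close>

lemma lborel_vec_2: "lborel = distr (lborel \<Otimes>\<^sub>M lborel) borel (\<lambda>(a, b). vector [a, b] :: real ^ 2)"
proof (rule lborel_eqI)
  fix l u :: "real ^ 2" assume "\<And>b. b \<in> Basis \<Longrightarrow> l \<bullet> b \<le> u \<bullet> b"
  then have le: "l $ i \<le> u $ i" for i
    using axis_in_Basis_iff[of i "1::real"] by (metis Basis_real_def insertI1 inner_axis inner_real_def mult.right_neutral)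
  have "(\<lambda>(a, b). vector [a, b] :: real ^ 2) -` box l u = {l $ 1<..<u $ 1} \<times> {l $ 2<..<u $ 2}"
    by (auto simp: mem_box_cart forall_2)
  then show "emeasure (distr (lborel \<Otimes>\<^sub>M lborel) borel (\<lambda>(a, b). vector [a, b])) (box l u)
      = ennreal (\<Prod>b\<in>Basis. (u - l) \<bullet> b)"
    using le by (simp add: emeasure_distr space_pair_measure lborel.emeasure_pair_measure_Times
        ennreal_mult[symmetric] Basis_vec_def prod.UNION_disjoint axis_eq_axis UNIV_2 inner_axis)
qed simp

section \<open>The polar map on the upper half plane\<close>

definition polar :: "real \<Rightarrow> real \<Rightarrow> real ^ 2" where
  "polar r t = vector [r * cos t, r * sin t]"

lemma polar_nth [simp]: "polar r t $ 1 = r * cos t" "polar r t $ 2 = r * sin t"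
  by (simp_all add: polar_def)

lemma norm_vec_2: "norm x = sqrt ((x $ 1)\<^sup>2 + (x $ 2)\<^sup>2)" for x :: "real ^ 2"
  by (simp add: norm_vec_def L2_set_def sum_2)

lemma norm_polar [simp]: "norm (polar r t) = \<bar>r\<bar>"
proof -
  have "(r * cos t)\<^sup>2 + (r * sin t)\<^sup>2 = r\<^sup>2 * ((cos t)\<^sup>2 + (sin t)\<^sup>2)"
    by (simp only: power_mult_distrib distrib_left)
  then show ?thesis by (simp add: norm_vec_2)
qed

lemma continuous_on_polar [continuous_intros]:
  fixes f g :: "'a::t2_space \<Rightarrow> real"
  shows "continuous_on S f \<Longrightarrow> continuous_on S g \<Longrightarrow> continuous_on S (\<lambda>x. polar (f x) (g x))"
  unfolding polar_def by (intro continuous_intros)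

lemma measurable_polar [measurable]: "(\<lambda>(r, t). polar r t) \<in> borel \<Otimes>\<^sub>M borel \<rightarrow>\<^sub>M borel"
  unfolding borel_prod by (intro borel_measurable_continuous_onI) (auto intro!: continuous_intros simp: case_prod_beta)

text \<open>In the closed upper half plane the sine of the angle is the nonnegative root, so
  \<open>arccos\<close> alone recovers the angle. At the origin the radius is 0 and any angle
  serves.\<close>

lemma polar_arccos:
  assumes "x $ 2 \<ge> 0"
  shows "polar (norm x) (arccos (x $ 1 / norm x)) = x"
proof (cases "x = 0")
  case True
  then show ?thesis by (simp add: vec_eq_iff forall_2)
next
  case False
  then have pos: "norm x > 0" by simp
  have le: "\<bar>x $ 1\<bar> \<le> norm x" by (rule component_le_norm_cart)
  have bd: "-1 \<le> x $ 1 / norm x" "x $ 1 / norm x \<le> 1"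
    using le pos by (auto simp: field_simps)
  have "1 - (x $ 1 / norm x)\<^sup>2 = (x $ 2 / norm x)\<^sup>2"
  proof -
    have n: "(x $ 2)\<^sup>2 = (norm x)\<^sup>2 - (x $ 1)\<^sup>2" by (simp add: norm_vec_2)
    show ?thesis
      using pos unfolding power_divide n by (simp add: diff_divide_distrib)
  qed
  then show ?thesis
    using bd assms pos False by (simp add: vec_eq_iff forall_2 sin_arccos real_sqrt_abs)
qed

text \<open>The polar map carries the half strip of radii r > 0 and angles in (0, pi) bijectively
  onto the open upper half plane, with Jacobian r. Fubini then splits the integral over the
  strip.\<close>

lemma nn_integral_polar:
  fixes f :: "real ^ 2 \<Rightarrow> ennreal"
  assumes f[measurable]: "f \<in> borel_measurable borel"
  shows "(\<integral>\<^sup>+x\<in>{x. x $ 2 > 0}. f x \<partial>lborel)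
    = (\<integral>\<^sup>+r\<in>{0<..}. (\<integral>\<^sup>+t\<in>{0<..<pi}. ennreal r * f (polar r t) \<partial>lborel) \<partial>lborel)"
proof -
  let ?S = "{x :: real ^ 2. 0 < x $ 1 \<and> 0 < x $ 2 \<and> x $ 2 < pi}"
  let ?g = "\<lambda>x :: real ^ 2. polar (x $ 1) (x $ 2)"
  let ?g' = "\<lambda>(x :: real ^ 2) h. vector [h $ 1 * cos (x $ 2) - x $ 1 * sin (x $ 2) * h $ 2,
      h $ 1 * sin (x $ 2) + x $ 1 * cos (x $ 2) * h $ 2] :: real ^ 2"
  have S[measurable]: "?S \<in> sets borel" by measurable
  have g[measurable]: "?g \<in> borel_measurable borel"
    by (intro borel_measurable_continuous_onI continuous_intros)
  have J: "\<bar>det (matrix (?g' x))\<bar> = \<bar>x $ 1\<bar>" for x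
  proof -
    have "det (matrix (?g' x)) = x $ 1 * (cos (x $ 2) * cos (x $ 2) + sin (x $ 2) * sin (x $ 2))"
      unfolding det_2 matrix_def by (simp add: axis_def distrib_left mult_ac del: sin_cos_squared_add3)
    then show ?thesis by (simp only: sin_cos_squared_add3 mult_1_right)
  qed
  have der: "(?g has_derivative ?g' x) (at x within ?S)" for x
  proof -
    have c: "((\<lambda>x :: real ^ 2. x $ i) has_derivative (\<lambda>h. h $ i)) (at x within ?S)" for i
      by (rule bounded_linear_imp_has_derivative[OF bounded_linear_vec_nth])
    have "((\<lambda>x. ?g x $ i) has_derivative (\<lambda>h. ?g' x h $ i)) (at x within ?S)" for i
      using exhaust_2[of i]
      by (auto intro!: derivative_eq_intros c simp: algebra_simps)
    then show ?thesis
      by (subst has_derivative_componentwise_within)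
        (auto simp: Basis_vec_def inner_axis)
  qed
  \<comment> \<open>The explicit inverse, defined on the whole plane. It yields injectivity,
    surjectivity and, being Borel, measurability of images.\<close>
  define h where "h = (\<lambda>y :: real ^ 2. vector [norm y, arccos (y $ 1 / norm y)] :: real ^ 2)"
  have hg: "h (?g x) = x" if "x \<in> ?S" for x
    using that by (simp add: h_def arccos_cos vec_eq_iff forall_2)
  have inj: "inj_on ?g ?S" using hg by (rule inj_on_inverseI)
  have gh: "?g (h y) = y \<and> h y \<in> ?S" if y: "y $ 2 > 0" for y
  proof -
    have "y \<noteq> 0" using y by auto
    moreover have "\<bar>y $ 1\<bar> < norm y"
      using y by (simp add: norm_vec_2 real_less_rsqrt)
    ultimately have "- 1 < y $ 1 / norm y" "y $ 1 / norm y < 1" by (auto simp: divide_simps abs_less_iff)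
    from arccos_lt_bounded[OF this] show ?thesis
      using polar_arccos[of y] y \<open>y \<noteq> 0\<close> by (simp add: h_def)
  qed
  have [measurable]: "h \<in> borel_measurable borel"
  proof -
    have "(\<lambda>y :: real ^ 2. arccos (y $ 1 / norm y)) \<in> borel_measurable borel"
    proof -
      \<comment> \<open>Clamping to [-1, 1] makes \<open>arccos\<close> continuous on the whole
        line. It changes nothing here, since the quotient has modulus at most 1, and equals 0 at the
        origin because division by 0 gives 0.\<close>
      have "max (-1) (min 1 (y $ 1 / norm y)) = y $ 1 / norm y" for y :: "real ^ 2"
      proof -
        have "\<bar>y $ 1 / norm y\<bar> \<le> 1"
          using component_le_norm_cart[of y 1] by (cases "y = 0") (auto simp: field_simps)
        then show ?thesis by linarith
      qed
      moreover have "continuous_on UNIV (\<lambda>z :: real. arccos (max (-1) (min 1 z)))"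
        by (intro continuous_intros) auto
      then have "(\<lambda>z :: real. arccos (max (-1) (min 1 z))) \<in> borel_measurable borel"
        by (rule borel_measurable_continuous_onI)
      then have "(\<lambda>y :: real ^ 2. arccos (max (-1) (min 1 (y $ 1 / norm y)))) \<in> borel_measurable borel"
        by (rule measurable_compose[rotated]) measurable
      ultimately show ?thesis by (simp only:)
    qed
    then have "(\<lambda>y :: real ^ 2. (\<lambda>(a, b). vector [a, b] :: real ^ 2) (norm y, arccos (y $ 1 / norm y))) \<in> borel_measurable borel"
      by measurable
    then show ?thesis by (simp add: h_def)
  qed
  have im: "?g ` ?S = {x. x $ 2 > 0}"
    using gh by (force simp: sin_gt_zero)
  have "(\<integral>\<^sup>+x\<in>?g ` ?S. f x \<partial>lborel) = (\<integral>\<^sup>+x\<in>?S. ennreal \<bar>det (matrix (?g' x))\<bar> * f (?g x) \<partial>lborel)"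
  proof (rule nn_integral_change_of_variables[OF S _ g der inj _ f])
    fix T assume T[measurable]: "T \<in> sets borel" "T \<subseteq> ?S"
    \<comment> \<open>The image under the polar map is a preimage under its inverse, hence
      Borel.\<close>
    have eq: "?g ` T = {y. y $ 2 > 0} \<inter> (h -` T \<inter> space borel)"
    proof (intro equalityI subsetI)
      fix y assume "y \<in> ?g ` T"
      then obtain x where x: "x \<in> T" "x \<in> ?S" "y = ?g x" using T(2) by blast
      then have "h y = x" "y $ 2 > 0" using hg sin_gt_zero by auto
      with x show "y \<in> {y. y $ 2 > 0} \<inter> (h -` T \<inter> space borel)" by simp
    next
      fix y assume "y \<in> {y. y $ 2 > 0} \<inter> (h -` T \<inter> space borel)"
      then have "h y \<in> T" "?g (h y) = y" using gh by auto
      then show "y \<in> ?g ` T" by (intro image_eqI[of _ _ "h y"]) simp_all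
    qed
    have "{y :: real ^ 2. y $ 2 > 0} \<in> sets borel" by measurable
    moreover have "h -` T \<inter> space borel \<in> sets borel" by (rule measurable_sets) measurable
    ultimately show "?g ` T \<in> sets borel" unfolding eq by (rule sets.Int)
  qed (simp add: J)
  also have "\<dots> = (\<integral>\<^sup>+x. ennreal (x $ 1) * f (?g x) * indicator ?S x \<partial>lborel)"
    by (auto simp: J indicator_def intro!: nn_integral_cong)
  also have "\<dots> = (\<integral>\<^sup>+(r, t). ennreal r * f (polar r t) * indicator ?S (vector [r, t]) \<partial>(lborel \<Otimes>\<^sub>M lborel))"
    by (subst lborel_vec_2, subst nn_integral_distr) (auto simp: case_prod_unfold)
  also have "\<dots> = (\<integral>\<^sup>+r. (\<integral>\<^sup>+t. ennreal r * f (polar r t) * indicator ?S (vector [r, t]) \<partial>lborel) \<partial>lborel)"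
    by (subst lborel.nn_integral_fst[symmetric]) (auto simp: case_prod_beta)
  also have "\<dots> = (\<integral>\<^sup>+r\<in>{0<..}. (\<integral>\<^sup>+t\<in>{0<..<pi}. ennreal r * f (polar r t) \<partial>lborel) \<partial>lborel)"
    by (subst nn_integral_multc[symmetric]) (auto simp: indicator_def intro!: nn_integral_cong)
  finally show ?thesis by (simp add: im)
qed

section \<open>Hausdorff measure of curves\<close>

text \<open>The one-dimensional unit ball has volume 2, which cancels the halving of the diameter.
  The empty set conforms because its diameter is 0.\<close>

lemma hausdorff_gauge_1: "hausdorff_gauge 1 C = ennreal (diameter C)"
  by (simp add: hausdorff_gauge_def unit_ball_vol_1)

text \<open>Cover \<open>T\<close> by short intervals with disjoint interiors inside an open set of
  nearly the same measure. Their images are admissible covering sets, and each has diameter at most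
  \<open>L\<close> times the length of its interval.\<close>

lemma hausdorff_measure_1_image_le:
  fixes \<gamma> :: "real \<Rightarrow> 'a::metric_space"
  assumes lip: "L-lipschitz_on X \<gamma>" and T: "T \<in> sets borel" "bounded T" "T \<subseteq> X"
  shows "hausdorff_measure 1 (\<gamma> ` T) \<le> ennreal L * emeasure lborel T"
proof -
  have L: "L \<ge> 0" using lip by (rule lipschitz_on_nonneg)
  obtain a b where ab: "T \<subseteq> cbox a b" "box a b \<noteq> {}"
  proof -
    obtain c where "T \<subseteq> cbox (- c) c" using bounded_subset_cbox_symmetric[OF T(2)] by blast
    \<comment> \<open>The absolute value and the margin 1 give the box a nonempty interior whatever
      \<open>c\<close> is, as the covering lemma demands.\<close>
    then have "T \<subseteq> cbox (- \<bar>c\<bar> - 1) (\<bar>c\<bar> + 1)" by auto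
    then show ?thesis by (rule that) auto
  qed
  have fin: "emeasure lborel T < \<infinity>" using emeasure_bounded_finite[OF T(2)] by simp
  have "(INF C \<in> {C :: nat \<Rightarrow> 'a set. \<gamma> ` T \<subseteq> (\<Union>i. C i) \<and> (\<forall>i. bounded (C i) \<and> diameter (C i) \<le> \<delta>)}.
          \<Sum>i. hausdorff_gauge 1 (C i)) \<le> ennreal L * emeasure lborel T" (is "?I \<le> _")
    if \<delta>: "\<delta> > 0" for \<delta>
  proof -
    have "?I \<le> ennreal L * (emeasure lborel T + ennreal e)" if e: "e > 0" for e
    proof -
      obtain U where U: "open U" "T \<subseteq> U" "emeasure lborel (U - T) < ennreal e"
        using outer_regular_lborel[OF T(1) e] by blast
      have emU: "emeasure lborel U \<le> emeasure lborel T + ennreal e"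
      proof -
        have "emeasure lborel U = emeasure lborel T + emeasure lborel (U - T)"
          using U T by (subst plus_emeasure) (auto simp: Un_absorb1)
        with U(3) show ?thesis by (simp add: add_left_mono less_imp_le)
      qed
      \<comment> \<open>The mesh. Intervals of length at most \<open>\<rho>\<close> have images of
        diameter at most \<open>L * \<rho> \<le> \<delta>\<close>; the summand 1 guards against
        \<open>L = 0\<close>.\<close>
      define \<rho> where "\<rho> = \<delta> / (L + 1)"
      have \<rho>: "\<rho> > 0" "L * \<rho> \<le> \<delta>" using \<delta> L by (auto simp: \<rho>_def field_simps)
      \<comment> \<open>A gauge must be given at every point. Since the covering intervals are
        tagged by points of \<open>T\<close>, only the first branch takes effect: it keeps them
        inside \<open>U\<close> and of length at most \<open>\<rho>\<close>.\<close>
      define g where "g = (\<lambda>x. if x \<in> U then U \<inter> ball x (\<rho> / 2) else ball x 1)"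
      have "gauge g" using U \<rho> by (auto simp: gauge_def g_def open_Int)
      from covering_lemma[OF ab this] obtain \<D> where
        \<D>: "countable \<D>" "\<And>K. K \<in> \<D> \<Longrightarrow> interior K \<noteq> {} \<and> (\<exists>c d. K = cbox c d)"
          "pairwise (\<lambda>A B. interior A \<inter> interior B = {}) \<D>"
          "\<And>K. K \<in> \<D> \<Longrightarrow> \<exists>x \<in> T \<inter> K. K \<subseteq> g x" "T \<subseteq> \<Union>\<D>" by metis
      \<comment> \<open>The covering family may be finite, whereas a Hausdorff cover is a full
        sequence. Indices outside \<open>N\<close> are padded with the empty set.\<close>
      define N where "N = to_nat_on \<D> ` \<D>"
      define K where "K = (\<lambda>i. if i \<in> N then from_nat_into \<D> i else {})"
      have K_in: "K i \<in> \<D>" if "i \<in> N" for i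
        using that \<D>(1) by (auto simp: K_def N_def)
      have K_inj: "K i \<noteq> K j" if "i \<in> N" "j \<in> N" "i \<noteq> j" for i j
        using that \<D>(1) by (auto simp: K_def N_def)
      have UK: "\<Union>\<D> \<subseteq> (\<Union>i. K i)"
      proof
        fix x assume "x \<in> \<Union>\<D>"
        then obtain D where D: "D \<in> \<D>" "x \<in> D" by blast
        then have "K (to_nat_on \<D> D) = D" using \<D>(1) by (simp add: K_def N_def)
        then show "x \<in> (\<Union>i. K i)" using D by blast
      qed
      have K_small: "K i \<subseteq> U \<and> (\<forall>s\<in>K i. \<forall>t\<in>K i. \<bar>s - t\<bar> \<le> \<rho>)" for i
      proof (cases "i \<in> N")
        case True
        then obtain x where x: "x \<in> T" "K i \<subseteq> g x" using \<D>(4)[OF K_in] by blast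
        then have sub: "K i \<subseteq> U" "K i \<subseteq> ball x (\<rho> / 2)" using U(2) by (auto simp: g_def split: if_splits)
        have "\<bar>s - t\<bar> \<le> \<rho>" if "s \<in> K i" "t \<in> K i" for s t
        proof -
          have "\<bar>x - s\<bar> < \<rho> / 2" "\<bar>x - t\<bar> < \<rho> / 2" using that sub(2) by (auto simp: dist_real_def)
          then show ?thesis by linarith
        qed
        with sub show ?thesis by blast
      qed (simp add: K_def)
      have K_box: "\<exists>c d. K i = {c..d}" for i
      proof (cases "i \<in> N")
        case True
        then show ?thesis using \<D>(2)[OF K_in] by (auto simp: cbox_interval)
      next
        case False
        then have "K i = {1..0}" by (simp add: K_def)
        then show ?thesis by blast
      qed
      \<comment> \<open>The intervals may stick out of \<open>X\<close>, where the Lipschitz bound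
        is not assumed.\<close>
      define C where "C = (\<lambda>i. \<gamma> ` (K i \<inter> X))"
      have Cdist: "dist y z \<le> L * r" if "y \<in> C i" "z \<in> C i" "\<forall>s\<in>K i. \<forall>t\<in>K i. \<bar>s - t\<bar> \<le> r" for i r y z
      proof -
        obtain s t where st: "y = \<gamma> s" "z = \<gamma> t" "s \<in> K i" "t \<in> K i" "s \<in> X" "t \<in> X"
          using \<open>y \<in> C i\<close> \<open>z \<in> C i\<close> by (auto simp: C_def)
        have "dist y z \<le> L * \<bar>s - t\<bar>"
          using lipschitz_onD[OF lip st(5,6)] by (simp add: st dist_real_def)
        also have "\<dots> \<le> L * r" using that(3) st L by (intro mult_left_mono) auto
        finally show ?thesis .
      qed
      have Cbd: "bounded (C i)" for i
        using Cdist[of _ i _ \<rho>] K_small[of i] unfolding bounded_two_points by blast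
      have Cdiam: "diameter (C i) \<le> L * r" if "r \<ge> 0" "\<forall>s\<in>K i. \<forall>t\<in>K i. \<bar>s - t\<bar> \<le> r" for i r
        unfolding diameter_def using Cdist[OF _ _ that(2)] that(1) L
        by (auto intro!: cSUP_least)
      have cover: "\<gamma> ` T \<subseteq> (\<Union>i. C i)" 
      proof (rule image_subsetI)
        fix t assume t: "t \<in> T"
        then obtain i where "t \<in> K i" using \<D>(5) UK by blast
        with t T(3) show "\<gamma> t \<in> (\<Union>i. C i)" unfolding C_def by blast
      qed
      have "diameter (C i) \<le> \<delta>" for i
        using Cdiam[of \<rho> i] K_small[of i] \<rho> by simp
      then have "?I \<le> (\<Sum>i. hausdorff_gauge 1 (C i))"
        using cover Cbd by (intro INF_lower) auto
      \<comment> \<open>Neighbouring intervals may share endpoints. Their interiors are disjoint and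
        have the same length, so the sum becomes the measure of a union contained in
        \<open>U\<close>.\<close>
      also have "\<dots> \<le> (\<Sum>i. ennreal L * emeasure lborel (interior (K i)))"
      proof (intro suminf_le)
        fix i
        obtain c d where cd: "K i = {c..d}" using K_box by blast
        show "hausdorff_gauge 1 (C i) \<le> ennreal L * emeasure lborel (interior (K i))"
        proof (cases "c \<le> d")
          case True
          then have "diameter (C i) \<le> L * (d - c)" by (intro Cdiam) (auto simp: cd)
          moreover have "emeasure lborel (interior (K i)) = ennreal (d - c)"
            using True by (simp add: cd interior_atLeastAtMost_real)
          ultimately show ?thesis using True L
            by (simp only: hausdorff_gauge_1) (simp add: ennreal_mult[symmetric] ennreal_leI)
        next
          case False
          then show ?thesis by (simp add: hausdorff_gauge_def C_def cd)
        qed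
      qed auto
      also have "\<dots> = ennreal L * (\<Sum>i. emeasure lborel (interior (K i)))"
        by simp
      also have "(\<Sum>i. emeasure lborel (interior (K i))) = emeasure lborel (\<Union>i. interior (K i))"
      proof (intro suminf_emeasure)
        have "interior (K i) \<inter> interior (K j) = {}" if "i \<noteq> j" for i j
        proof (cases "i \<in> N \<and> j \<in> N")
          case True
          then show ?thesis using \<D>(3) K_in K_inj that by (auto simp: pairwise_def)
        qed (auto simp: K_def)
        then show "disjoint_family (\<lambda>i. interior (K i))" by (auto simp: disjoint_family_on_def)
      qed auto
      also have "emeasure lborel (\<Union>i. interior (K i)) \<le> emeasure lborel U"
        using K_small U(1) interior_subset by (intro emeasure_mono) (blast, auto)
      also note emU
      finally show ?thesis by (simp add: mult_left_mono)
    qed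
    then have *: "?I \<le> ennreal L * emeasure lborel T + ennreal (L * e)" if "e > 0" for e
      using that L by (simp add: distrib_left ennreal_mult)
    show ?thesis
    proof (rule ennreal_le_epsilon)
      fix e :: real assume e: "e > 0"
      have "?I \<le> ennreal L * emeasure lborel T + ennreal (L * (e / (L + 1)))"
        using L e by (intro *) auto
      also have "\<dots> \<le> ennreal L * emeasure lborel T + ennreal e"
        using L e by (intro add_left_mono ennreal_leI) (auto simp: field_simps)
      finally show "?I \<le> ennreal L * emeasure lborel T + ennreal e" .
    qed
  qed
  then show ?thesis unfolding hausdorff_measure_def by (intro SUP_least) auto
qed

text \<open>Pull a cover of the curve back to the parameter line. By \<open>expand\<close>, a
  covering set of small diameter has a preimage of diameter at most (1 + \<epsilon>) / c times its
  own, so countable subadditivity bounds the measure of \<open>T\<close>. Note that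
  \<open>expand\<close> forces \<open>\<gamma>\<close> to be injective on \<open>T\<close>, so no
  arc is counted twice.\<close>

lemma hausdorff_measure_1_image_ge:
  fixes \<gamma> :: "real \<Rightarrow> 'a::metric_space"
  assumes "c > 0" and T: "T \<in> sets borel"
    and expand: "\<And>\<epsilon>. \<epsilon> > 0 \<Longrightarrow> \<exists>\<delta>>0. \<forall>s\<in>T. \<forall>t\<in>T. dist (\<gamma> s) (\<gamma> t) \<le> \<delta> \<longrightarrow> c * \<bar>s - t\<bar> \<le> (1 + \<epsilon>) * dist (\<gamma> s) (\<gamma> t)"
  shows "ennreal c * emeasure lborel T \<le> hausdorff_measure 1 (\<gamma> ` T)" (is "_ \<le> ?H")
proof -
  have *: "ennreal c * emeasure lborel T \<le> ennreal (1 + \<epsilon>) * ?H" if \<epsilon>: "\<epsilon> > 0" for \<epsilon>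
  proof -
    obtain \<delta> where \<delta>: "\<delta> > 0"
      "\<And>s t. s \<in> T \<Longrightarrow> t \<in> T \<Longrightarrow> dist (\<gamma> s) (\<gamma> t) \<le> \<delta> \<Longrightarrow> c * \<bar>s - t\<bar> \<le> (1 + \<epsilon>) * dist (\<gamma> s) (\<gamma> t)"
      using expand[OF \<epsilon>] by blast
    have "ennreal (c / (1 + \<epsilon>)) * emeasure lborel T \<le> (\<Sum>i. hausdorff_gauge 1 (C i))"
      if C: "\<gamma> ` T \<subseteq> (\<Union>i. C i)" "\<And>i. bounded (C i)" "\<And>i. diameter (C i) \<le> \<delta>" for C :: "nat \<Rightarrow> 'a set"
    proof -
      define B where "B = (\<lambda>i. {t \<in> T. \<gamma> t \<in> C i})"
      \<comment> \<open>The covering sets are arbitrary, so \<open>B i\<close> need not be Borel.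
        Its interval hull is Borel and no longer than the diameter bound for \<open>B i\<close>. The
        empty case is separate because \<open>Inf\<close> and \<open>Sup\<close> carry no
        information there.\<close>
      define J where "J = (\<lambda>i. if B i = {} then {} else {Inf (B i)..Sup (B i)})"
      have B: "\<bar>s - t\<bar> \<le> (1 + \<epsilon>) / c * diameter (C i)" if "s \<in> B i" "t \<in> B i" for s t i
      proof -
        have d: "dist (\<gamma> s) (\<gamma> t) \<le> diameter (C i)"
          using that C(2) by (auto simp: B_def intro: diameter_bounded_bound)
        then have "c * \<bar>s - t\<bar> \<le> (1 + \<epsilon>) * dist (\<gamma> s) (\<gamma> t)"
          using that C(3)[of i] by (intro \<delta>(2)) (auto simp: B_def)
        also have "\<dots> \<le> (1 + \<epsilon>) * diameter (C i)" using d \<epsilon> by (intro mult_left_mono) auto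
        finally show ?thesis using \<open>c > 0\<close> by (simp add: field_simps)
      qed
      have bdd: "bdd_below (B i)" "bdd_above (B i)" for i
      proof -
        have "bounded (B i)" unfolding bounded_two_points dist_real_def using B by blast
        then show "bdd_below (B i)" "bdd_above (B i)"
          by (simp_all add: bounded_imp_bdd_below bounded_imp_bdd_above)
      qed
      have BJ: "B i \<subseteq> J i" for i
        using bdd[of i] by (auto simp: J_def intro: cInf_lower cSup_upper)
      have J: "ennreal (c / (1 + \<epsilon>)) * emeasure lborel (J i) \<le> hausdorff_gauge 1 (C i)" for i
      proof (cases "B i = {}")
        case False
        let ?d = "(1 + \<epsilon>) / c * diameter (C i)"
        have "Sup (B i) \<le> Inf (B i) + ?d"
        proof (rule cSup_least[OF False])
          fix s assume s: "s \<in> B i"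
          have "s - ?d \<le> Inf (B i)"
            by (rule cInf_greatest[OF False]) (use B[OF s] in \<open>force simp: abs_le_iff\<close>)
          then show "s \<le> Inf (B i) + ?d" by linarith
        qed
        moreover have "Inf (B i) \<le> Sup (B i)" using bdd False by (intro cInf_le_cSup) auto
        ultimately have "emeasure lborel (J i) \<le> ennreal ?d"
          using False by (simp add: J_def ennreal_leI)
        then have "ennreal (c / (1 + \<epsilon>)) * emeasure lborel (J i) \<le> ennreal (c / (1 + \<epsilon>)) * ennreal ?d"
          by (intro mult_left_mono) auto
        also have "\<dots> = ennreal (diameter (C i))"
          using \<open>c > 0\<close> \<epsilon> diameter_ge_0[OF C(2)[of i]] by (subst ennreal_mult[symmetric]) auto
        finally show ?thesis by (simp only: hausdorff_gauge_1)
      qed (simp add: J_def)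
      have "emeasure lborel T \<le> emeasure lborel (\<Union>i. J i)"
      proof (rule emeasure_mono)
        have "t \<in> (\<Union>i. B i)" if "t \<in> T" for t
          using C(1) that by (auto simp: B_def)
        then show "T \<subseteq> (\<Union>i. J i)" using BJ by blast
        show "(\<Union>i. J i) \<in> sets lborel" by (auto simp: J_def)
      qed
      also have "\<dots> \<le> (\<Sum>i. emeasure lborel (J i))"
        by (intro emeasure_subadditive_countably) (auto simp: J_def)
      finally have "ennreal (c / (1 + \<epsilon>)) * emeasure lborel T
          \<le> ennreal (c / (1 + \<epsilon>)) * (\<Sum>i. emeasure lborel (J i))" by (intro mult_left_mono) auto
      also have "\<dots> = (\<Sum>i. ennreal (c / (1 + \<epsilon>)) * emeasure lborel (J i))" by simp
      also have "\<dots> \<le> (\<Sum>i. hausdorff_gauge 1 (C i))" by (intro suminf_le J) auto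
      finally show ?thesis .
    qed
    then have "ennreal (c / (1 + \<epsilon>)) * emeasure lborel T
      \<le> (INF C \<in> {C :: nat \<Rightarrow> 'a set. \<gamma> ` T \<subseteq> (\<Union>i. C i) \<and> (\<forall>i. bounded (C i) \<and> diameter (C i) \<le> \<delta>)}.
          \<Sum>i. hausdorff_gauge 1 (C i))" by (intro INF_greatest) auto
    also have "\<dots> \<le> ?H" unfolding hausdorff_measure_def using \<delta>(1) by (intro SUP_upper2[of \<delta>]) auto
    finally have "ennreal (1 + \<epsilon>) * (ennreal (c / (1 + \<epsilon>)) * emeasure lborel T) \<le> ennreal (1 + \<epsilon>) * ?H"
      by (intro mult_left_mono) auto
    moreover have "ennreal (1 + \<epsilon>) * (ennreal (c / (1 + \<epsilon>)) * emeasure lborel T) = ennreal c * emeasure lborel T"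
      using \<epsilon> \<open>c > 0\<close> unfolding mult.assoc[symmetric] by (subst ennreal_mult[symmetric]) auto
    ultimately show ?thesis by simp
  qed
  show ?thesis
  proof (cases ?H rule: ennreal_cases)
    case (real h)
    show ?thesis
    proof (rule ennreal_le_epsilon)
      fix e :: real assume e: "e > 0"
      \<comment> \<open>Letting \<epsilon> tend to 0: with \<epsilon> = e / (h + 1) the excess
        \<epsilon> * h is at most e, also when h = 0.\<close>
      have "ennreal c * emeasure lborel T \<le> ennreal (1 + e / (h + 1)) * ?H"
        using e real by (intro *) auto
      also have "\<dots> = ennreal ((1 + e / (h + 1)) * h)"
        using e real by (simp add: ennreal_mult)
      also have "\<dots> \<le> ennreal (h + e)" using e real by (intro ennreal_leI) (auto simp: field_simps)
      also have "\<dots> = ?H + ennreal e" using e real by simp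
      finally show "ennreal c * emeasure lborel T \<le> ?H + ennreal e" .
    qed
  qed simp
qed

section \<open>Arc length on circles\<close>

lemma dist_polar: "dist (polar r s) (polar r t) = 2 * \<bar>r\<bar> * \<bar>sin ((s - t) / 2)\<bar>"
proof -
  have c: "cos (s - t) = 1 - 2 * (sin ((s - t) / 2))\<^sup>2"
    using cos_double_sin[of "(s - t) / 2"] by (simp only: mult_2 field_sum_of_halves)
  have "(r * cos s - r * cos t)\<^sup>2 + (r * sin s - r * sin t)\<^sup>2
      = r\<^sup>2 * (((cos s)\<^sup>2 + (sin s)\<^sup>2) + ((cos t)\<^sup>2 + (sin t)\<^sup>2) - 2 * (cos s * cos t + sin s * sin t))"
    by algebra
  also have "\<dots> = r\<^sup>2 * (2 - 2 * cos (s - t))"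
    by (simp add: cos_diff)
  also have "\<dots> = (2 * \<bar>r\<bar> * \<bar>sin ((s - t) / 2)\<bar>)\<^sup>2"
    unfolding c by (simp add: power_mult_distrib)
  finally have "norm (polar r s - polar r t) = sqrt ((2 * \<bar>r\<bar> * \<bar>sin ((s - t) / 2)\<bar>)\<^sup>2)"
    by (simp add: norm_vec_2)
  then show ?thesis by (simp add: dist_norm)
qed

text \<open>The difference sin x - x cos x vanishes at 0 and has derivative x sin x, nonnegative on
  [0, pi]. This bounds an arc by its chord up to the cosine.\<close>

lemma mult_cos_le_sin:
  fixes x :: real
  assumes "0 \<le> x" "x \<le> pi"
  shows "x * cos x \<le> sin x"
proof -
  have "sin 0 - 0 * cos 0 \<le> sin x - x * cos x"
  proof (rule DERIV_nonneg_imp_nondecreasing[OF assms(1)])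
    fix y assume "0 \<le> y" "y \<le> x"
    then have "0 \<le> y * sin y" using assms by (intro mult_nonneg_nonneg sin_ge_zero) auto
    moreover have "((\<lambda>y. sin y - y * cos y) has_real_derivative y * sin y) (at y)"
      by (auto intro!: derivative_eq_intros)
    ultimately show "\<exists>z. ((\<lambda>y. sin y - y * cos y) has_real_derivative z) (at y) \<and> 0 \<le> z" by blast
  qed
  then show ?thesis by simp
qed

lemma surface_area_arc:
  assumes r: "r > 0" and T: "T \<in> sets borel" "T \<subseteq> {0..pi}"
  shows "surface_area (polar r ` T) = ennreal r * emeasure lborel T"
proof (rule antisym)
  have "r-lipschitz_on UNIV (polar r)"
  proof (rule lipschitz_onI)
    fix s t
    have "dist (polar r s) (polar r t) \<le> 2 * r * \<bar>(s - t) / 2\<bar>"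
      unfolding dist_polar using r abs_sin_x_le_abs_x[of "(s - t) / 2"] by (simp del: abs_divide)
    then show "dist (polar r s) (polar r t) \<le> r * dist s t" by (simp add: dist_real_def)
  qed (use r in simp)
  moreover have "bounded T" using bounded_subset[OF bounded_closed_interval T(2)] .
  ultimately show "surface_area (polar r ` T) \<le> ennreal r * emeasure lborel T"
    unfolding surface_area_def using hausdorff_measure_1_image_le[of r UNIV "polar r" T] T by simp
next
  have "\<exists>\<delta>>0. \<forall>s\<in>T. \<forall>t\<in>T. dist (polar r s) (polar r t) \<le> \<delta> \<longrightarrow>
      r * \<bar>s - t\<bar> \<le> (1 + \<epsilon>) * dist (polar r s) (polar r t)" if \<epsilon>: "\<epsilon> > 0" for \<epsilon>
  proof -
    \<comment> \<open>Chosen so that sin u \<le> \<eta> gives cos^2 u \<ge> 1 / (1 + \<epsilon>),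
      where u is half the angle between the two points.\<close>
    define \<eta> where "\<eta> = sqrt (\<epsilon> / (1 + \<epsilon>))"
    have \<eta>: "\<eta> > 0" "1 - \<eta>\<^sup>2 = 1 / (1 + \<epsilon>)" using \<epsilon> by (auto simp: \<eta>_def field_simps)
    have "r * \<bar>s - t\<bar> \<le> (1 + \<epsilon>) * dist (polar r s) (polar r t)"
      if "s \<in> T" "t \<in> T" and d: "dist (polar r s) (polar r t) \<le> 2 * r * \<eta>" for s t
    proof -
      define u where "u = \<bar>s - t\<bar> / 2"
      \<comment> \<open>Half the angle is at most pi / 2, where sine increases, so a short chord
        forces a short arc. On a full circle the endpoints 0 and 2 pi would violate this.\<close>
      have "s \<in> {0..pi}" "t \<in> {0..pi}" using that T by auto
      then have u: "0 \<le> u" "u \<le> pi / 2" by (auto simp: u_def)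
      have "u = (s - t) / 2 \<or> u = - ((s - t) / 2)" unfolding u_def by (cases "t \<le> s") linarith+
      then have "\<bar>sin ((s - t) / 2)\<bar> = \<bar>sin u\<bar>" by (auto simp only: sin_minus abs_minus_cancel)
      then have dist: "dist (polar r s) (polar r t) = 2 * r * sin u"
        using r u sin_ge_zero[of u] by (simp add: dist_polar)
      then have "sin u \<le> \<eta>" using d r by simp
      then have "(sin u)\<^sup>2 \<le> \<eta>\<^sup>2" using u by (intro power_mono sin_ge_zero) auto
      then have "1 / (1 + \<epsilon>) \<le> (cos u)\<^sup>2" by (simp add: cos_squared_eq flip: \<eta>(2))
      also have "\<dots> \<le> cos u" using u cos_ge_zero[of u] by (simp add: power2_eq_square mult_left_le)
      finally have "u * (1 / (1 + \<epsilon>)) \<le> u * cos u" using u by (intro mult_left_mono)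
      also have "\<dots> \<le> sin u" using u by (intro mult_cos_le_sin) auto
      finally have "u \<le> (1 + \<epsilon>) * sin u" using \<epsilon> by (simp add: field_simps)
      then have "2 * r * u \<le> 2 * r * ((1 + \<epsilon>) * sin u)" using r by (intro mult_left_mono) auto
      then show ?thesis by (simp add: dist u_def mult_ac)
    qed
    then show ?thesis using r \<eta>(1) by (intro exI[of _ "2 * r * \<eta>"]) auto
  qed
  from hausdorff_measure_1_image_ge[OF r T(1) this]
  show "ennreal r * emeasure lborel T \<le> surface_area (polar r ` T)"
    by (simp add: surface_area_def)
qed

lemma upper_semicircle_eq_polar:
  assumes "r \<ge> 0"
  shows "{x. x $ 2 \<ge> 0 \<and> norm x = r} = polar r ` {0..pi}"
proof (intro equalityI subsetI)
  fix x :: "real ^ 2" assume x: "x \<in> {x. x $ 2 \<ge> 0 \<and> norm x = r}"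
  have "\<bar>x $ 1 / norm x\<bar> \<le> 1"
    using component_le_norm_cart[of x 1] by (cases "x = 0") (auto simp: field_simps)
  then have "arccos (x $ 1 / norm x) \<in> {0..pi}"
    by (simp only: atLeastAtMost_iff abs_le_iff) (intro conjI arccos_lbound arccos_ubound; linarith)
  then show "x \<in> polar r ` {0..pi}" using polar_arccos[of x] x by (intro image_eqI[of _ _ "arccos (x $ 1 / norm x)"]) auto
qed (use assms in \<open>auto intro!: mult_nonneg_nonneg sin_ge_zero\<close>)

text \<open>Both the part in \<open>A\<close> and the whole half circle have length r times the
  measure of their angles. The factor r cancels, so the angle is uniform on (0, pi) for every
  radius.\<close>

lemma uniform_surface_upper_semicircle:
  assumes r: "r > 0" and A: "A \<in> sets borel"
  shows "uniform_surface {x. x $ 2 \<ge> 0 \<and> norm x = r} A = emeasure lborel {t \<in> {0<..<pi}. polar r t \<in> A} / ennreal pi"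
proof -
  have m: "{t \<in> I. polar r t \<in> A} \<in> sets borel" if "I \<in> sets borel" for I
  proof -
    have "polar r \<in> borel_measurable borel" by (intro borel_measurable_continuous_onI continuous_intros)
    then have "I \<inter> (polar r -` A \<inter> space borel) \<in> sets borel" using that A by (intro sets.Int measurable_sets)
    moreover have "I \<inter> (polar r -` A \<inter> space borel) = {t \<in> I. polar r t \<in> A}" by auto
    ultimately show ?thesis by simp
  qed
  have "{x. x $ 2 \<ge> 0 \<and> norm x = r} \<inter> A = polar r ` {t \<in> {0..pi}. polar r t \<in> A}"
    using upper_semicircle_eq_polar[of r] r by auto
  \<comment> \<open>The level set contains its two boundary points with \<open>\<sigma> = 0\<close>,
    which lie only in the closure of the parameter set. They are null.\<close>
  moreover have "emeasure lborel {t \<in> {0..pi}. polar r t \<in> A} = emeasure lborel {t \<in> {0<..<pi}. polar r t \<in> A}"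
  proof (rule emeasure_eq_AE)
    show "AE t in lborel. t \<in> {t \<in> {0..pi}. polar r t \<in> A} \<longleftrightarrow> t \<in> {t \<in> {0<..<pi}. polar r t \<in> A}"
      using AE_lborel_singleton[of "0::real"] AE_lborel_singleton[of pi]
      by eventually_elim auto
  qed (simp_all only: sets_lborel m borel_closed closed_atLeastAtMost borel_open open_greaterThanLessThan)
  moreover have "surface_area (polar r ` {0..pi}) = ennreal r * ennreal pi"
    using r by (subst surface_area_arc) auto
  moreover have "surface_area (polar r ` {t \<in> {0..pi}. polar r t \<in> A})
      = ennreal r * emeasure lborel {t \<in> {0..pi}. polar r t \<in> A}"
    by (rule surface_area_arc[OF r m]) auto
  ultimately have "uniform_surface {x. x $ 2 \<ge> 0 \<and> norm x = r} A
      = (ennreal r * emeasure lborel {t \<in> {0<..<pi}. polar r t \<in> A}) / (ennreal r * ennreal pi)"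
    using r upper_semicircle_eq_polar[of r] by (simp only: uniform_surface_def)
  also have "\<dots> = (ennreal r / ennreal r) * (emeasure lborel {t \<in> {0<..<pi}. polar r t \<in> A} / ennreal pi)"
    using r by (simp only: divide_ennreal_def ennreal_inverse_mult ennreal_less_top mult_ac)
  also have "ennreal r / ennreal r = 1" using r by (intro ennreal_divide_self) auto
  finally show ?thesis by simp
qed

section \<open>The Wasserstein distance and its extension\<close>

text \<open>A globally continuous \<open>F\<close> agreeing with the distance on parameters supplies
  the limit at every extended point, so the extension never has to be computed from its
  definition.\<close>

lemma filterlim_param_filter:
  assumes F: "continuous_on UNIV F" and eq: "\<And>\<theta>. \<theta> \<in> \<Theta> \<Longrightarrow> W2 \<mu>b \<mu> \<theta> = F (embed \<theta>)"
  shows "(W2 \<mu>b \<mu> \<longlongrightarrow> F x) (param_filter \<Theta> x)"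
proof -
  have "filterlim F (nhds (F x)) (nhds x)"
    using F by (simp add: continuous_on_def tendsto_at_iff_tendsto_nhds)
  then have "filterlim (\<lambda>\<theta>. F (embed \<theta>)) (nhds (F x)) (filtercomap embed (nhds x))"
    by (rule filterlim_compose[OF _ filterlim_filtercomap])
  then have "((\<lambda>\<theta>. F (embed \<theta>)) \<longlongrightarrow> F x) (param_filter \<Theta> x)"
    unfolding param_filter_def by (rule filterlim_mono) auto
  moreover have "eventually (\<lambda>\<theta>. \<theta> \<in> \<Theta>) (param_filter \<Theta> x)"
    by (simp add: param_filter_def eventually_inf_principal)
  then have "eventually (\<lambda>\<theta>. F (embed \<theta>) = W2 \<mu>b \<mu> \<theta>) (param_filter \<Theta> x)"
    by eventually_elim (simp add: eq)
  ultimately show ?thesis by (rule Lim_transform_eventually)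
qed

text \<open>Every neighbourhood of a point of the closure meets the embedded parameters. Properness
  of the filter makes the limit unique and hence determines \<open>Lim\<close>.\<close>

lemma param_filter_neq_bot:
  assumes "x \<in> ext_closure \<Theta>"
  shows "param_filter \<Theta> x \<noteq> bot"
proof
  assume "param_filter \<Theta> x = bot"
  then have "eventually (\<lambda>_. False) (param_filter \<Theta> x)" by simp
  then obtain Q where Q: "eventually Q (nhds x)" "\<And>\<theta>. Q (embed \<theta>) \<Longrightarrow> \<theta> \<notin> \<Theta>"
    by (auto simp: param_filter_def eventually_inf_principal eventually_filtercomap)
  then obtain U where "open U" "x \<in> U" "\<And>y. y \<in> U \<Longrightarrow> Q y" by (auto simp: eventually_nhds)
  with Q(2) assms show False
    unfolding ext_closure_def closure_iff_nhds_not_empty by (metis disjoint_iff imageE subset_refl)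
qed

lemma W2_ext_eqI:
  assumes "continuous_on UNIV F" "\<And>\<theta>. \<theta> \<in> \<Theta> \<Longrightarrow> W2 \<mu>b \<mu> \<theta> = F (embed \<theta>)" "x \<in> ext_closure \<Theta>"
  shows "W2_ext \<Theta> \<mu>b \<mu> x = F x"
  unfolding W2_ext_def using filterlim_param_filter[OF assms(1,2)] param_filter_neq_bot[OF assms(3)]
  by (intro tendsto_Lim)

section \<open>The norm on the extended plane\<close>

lemma embed_nth [simp]: "embed x $ i = ereal (x $ i)"
  by (simp add: embed_def)

lemma continuous_on_embed: "continuous_on S embed"
  unfolding embed_def by (intro continuous_intros)

text \<open>A continuous image of the product of two compact lines. Closed level sets are thereby
  compact.\<close>

lemma compact_UNIV_ereal_2: "compact (UNIV :: (ereal ^ 2) set)"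
proof -
  have "compact ((\<lambda>(a, b). vector [a, b] :: ereal ^ 2) ` (UNIV \<times> UNIV))"
    unfolding case_prod_unfold
    by (intro compact_continuous_image compact_Times compact_UNIV continuous_on_vector_2 continuous_intros)
  moreover have "(\<lambda>(a, b). vector [a, b] :: ereal ^ 2) ` (UNIV \<times> UNIV) = UNIV"
  proof -
    have "x \<in> (\<lambda>(a, b). vector [a, b] :: ereal ^ 2) ` (UNIV \<times> UNIV)" for x
      by (rule image_eqI[of _ _ "(x $ 1, x $ 2)"]) (simp_all add: vector_2_eq)
    then show ?thesis by blast
  qed
  ultimately show ?thesis by simp
qed

text \<open>The continuous extension of the Euclidean norm. The case distinction matters because
  \<open>real_of_ereal\<close> sends the infinities to 0.\<close>

definition norm_ext :: "ereal ^ 'd::finite \<Rightarrow> ennreal" where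
  "norm_ext x = (if \<exists>i. \<bar>x $ i\<bar> = \<infinity> then \<infinity> else ennreal (norm (\<chi> i. real_of_ereal (x $ i))))"

lemma norm_ext_embed [simp]: "norm_ext (embed x) = ennreal (norm x)"
  by (simp add: norm_ext_def)

lemma norm_ext_eq_infinity_iff: "norm_ext x = \<infinity> \<longleftrightarrow> x \<notin> range embed"
proof
  assume *: "norm_ext x = \<infinity>"
  show "x \<notin> range embed"
    using * by auto
next
  assume "x \<notin> range embed"
  moreover have "x = embed (\<chi> i. real_of_ereal (x $ i))" if "\<not> (\<exists>i. \<bar>x $ i\<bar> = \<infinity>)"
    using that by (simp add: vec_eq_iff ereal_real)
  ultimately show "norm_ext x = \<infinity>" unfolding norm_ext_def by (metis rangeI)
qed

text \<open>Near a finite point all coordinates are finite and \<open>real_of_ereal\<close> is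
  continuous. Near an infinite point a single infinite coordinate already exceeds any bound, and the
  norm dominates it.\<close>

lemma continuous_on_norm_ext: "continuous_on UNIV (norm_ext :: ereal ^ 'd::finite \<Rightarrow> ennreal)"
proof -
  have "(norm_ext \<longlongrightarrow> norm_ext x) (nhds x)" for x :: "ereal ^ 'd"
  proof (cases "x \<in> range embed")
    case True
    then obtain \<theta> where \<theta>: "x = embed \<theta>" by blast
    have nth: "((\<lambda>y. y $ i) \<longlongrightarrow> ereal (\<theta> $ i)) (nhds x)" for i
      unfolding \<theta> embed_nth[symmetric] by (rule tendsto_vec_nth[OF filterlim_ident])
    have lim: "((\<lambda>y. ennreal (norm (\<chi> i. real_of_ereal (y $ i)))) \<longlongrightarrow> ennreal (norm (\<chi> i. \<theta> $ i))) (nhds x)"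
      by (intro tendsto_ennrealI tendsto_norm tendsto_vec_lambda lim_real_of_ereal nth)
    have "eventually (\<lambda>y. \<bar>y $ i\<bar> \<noteq> \<infinity>) (nhds x)" for i
    proof -
      have "eventually (\<lambda>y. -\<infinity> < y $ i) (nhds x)" "eventually (\<lambda>y. y $ i < \<infinity>) (nhds x)"
        by (rule order_tendstoD(1)[OF nth[of i]], simp) (rule order_tendstoD(2)[OF nth[of i]], simp)
      then show ?thesis by eventually_elim auto
    qed
    then have "eventually (\<lambda>y. \<forall>i. \<bar>y $ i\<bar> \<noteq> \<infinity>) (nhds x)" by (simp add: eventually_all_finite)
    then have "eventually (\<lambda>y. ennreal (norm (\<chi> i. real_of_ereal (y $ i))) = norm_ext y) (nhds x)"
      by eventually_elim (simp add: norm_ext_def)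
    with lim have "(norm_ext \<longlongrightarrow> ennreal (norm (\<chi> i. \<theta> $ i))) (nhds x)"
      by (rule Lim_transform_eventually)
    then show ?thesis by (simp add: \<theta>)
  next
    case False
    then have top: "norm_ext x = \<infinity>" using norm_ext_eq_infinity_iff[of x] by blast
    then obtain i where i: "\<bar>x $ i\<bar> = \<infinity>" by (auto simp: norm_ext_def split: if_splits)
    have nth: "((\<lambda>y. y $ i) \<longlongrightarrow> x $ i) (nhds x)"
      by (rule tendsto_vec_nth[OF filterlim_ident])
    show ?thesis
    proof (rule order_tendstoI)
      fix a assume "a < norm_ext x"
      then obtain r where r: "a = ennreal r" "r \<ge> 0" using top by (cases a rule: ennreal_cases) auto
      have "x $ i = \<infinity> \<or> x $ i = -\<infinity>" using i by (cases "x $ i") auto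
      then have "eventually (\<lambda>y. ereal r < \<bar>y $ i\<bar>) (nhds x)"
      proof
        assume "x $ i = \<infinity>"
        then have "eventually (\<lambda>y. ereal r < y $ i) (nhds x)" by (intro order_tendstoD[OF nth]) simp
        then show ?thesis
        proof eventually_elim
          case (elim y)
          then show ?case by (cases "y $ i") auto
        qed
      next
        assume "x $ i = -\<infinity>"
        then have "eventually (\<lambda>y. y $ i < - ereal r) (nhds x)" by (intro order_tendstoD[OF nth]) simp
        then show ?thesis
        proof eventually_elim
          case (elim y)
          then show ?case by (cases "y $ i") auto
        qed
      qed
      then show "eventually (\<lambda>y. a < norm_ext y) (nhds x)"
      proof eventually_elim
        case (elim y)
        show ?case
        proof (cases "\<exists>i. \<bar>y $ i\<bar> = \<infinity>")
          case False
          have "\<bar>real_of_ereal (y $ i)\<bar> \<le> norm (\<chi> i. real_of_ereal (y $ i))"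
            using component_le_norm_cart[of "\<chi> i. real_of_ereal (y $ i)" i] by simp
          moreover have "r < \<bar>real_of_ereal (y $ i)\<bar>"
            using elim spec[OF False[simplified], of i] by (cases "y $ i") auto
          ultimately have "r < norm (\<chi> i. real_of_ereal (y $ i))" by linarith
          then have "a < ennreal (norm (\<chi> i. real_of_ereal (y $ i)))"
            using r by (simp add: ennreal_less_iff)
          then show ?thesis using False by (simp only: norm_ext_def if_False)
        qed (simp add: norm_ext_def r)
      qed
    qed (simp add: top)
  qed
  then show ?thesis
    by (simp add: continuous_on_def tendsto_at_iff_tendsto_nhds)
qed

text \<open>The closed half plane is the closure in the finite plane, and the continuous embedding
  maps it into the extended closure. An exact description is given for finite points, the only ones
  on finite levels.\<close>

lemma ext_closure_gaussian_params:
  "ext_closure gaussian_params \<subseteq> {x. x $ 2 \<ge> 0}"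
  "embed \<theta> \<in> ext_closure gaussian_params \<longleftrightarrow> \<theta> $ 2 \<ge> 0"
proof -
  have "closed {x :: ereal ^ 2. x $ 2 \<ge> 0}" by (intro closed_Collect_le continuous_intros)
  then show sub: "ext_closure gaussian_params \<subseteq> {x. x $ 2 \<ge> 0}"
    unfolding ext_closure_def by (rule closure_minimal[rotated]) (auto simp: gaussian_params_def)
  have "embed \<theta> \<in> ext_closure gaussian_params" if "\<theta> $ 2 \<ge> 0"
  proof -
    have "embed ` closure gaussian_params \<subseteq> ext_closure gaussian_params"
      unfolding ext_closure_def by (intro image_closure_subset continuous_on_embed closed_closure closure_subset)
    moreover have "\<theta> \<in> closure gaussian_params" using that by (simp add: gaussian_params_def)
    ultimately show ?thesis by blast
  qed
  then show "embed \<theta> \<in> ext_closure gaussian_params \<longleftrightarrow> \<theta> $ 2 \<ge> 0" using sub by auto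
qed

section \<open>Transport from a point mass to a normal law\<close>

text \<open>Under any coupling the first coordinate is almost surely 0, so all couplings have the
  second moment as cost.\<close>

lemma wasserstein2_return_0:
  assumes \<nu>: "prob_space \<nu>" "sets \<nu> = sets borel" and m: "(\<integral>\<^sup>+y. ennreal (y\<^sup>2) \<partial>\<nu>) = ennreal m" "m \<ge> 0"
  shows "wasserstein2 (return borel 0) \<nu> = ennreal (sqrt m)"
proof -
  have meas[measurable_cong]: "sets \<nu> = sets borel" by fact
  have cost: "(\<integral>\<^sup>+z. ennreal (\<bar>fst z - snd z\<bar>\<^sup>2) \<partial>M) = ennreal m" if M: "coupling (return borel 0) \<nu> M" for M
  proof -
    have [measurable_cong]: "sets M = sets (borel \<Otimes>\<^sub>M borel)"
      and d: "distr M borel fst = return borel 0" "distr M borel snd = \<nu>" using M by (auto simp: coupling_def)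
    have [measurable]: "fst \<in> borel_measurable M" "snd \<in> borel_measurable M" by measurable
    have "AE x in distr M borel fst. x = 0" unfolding d by (simp add: AE_return)
    then have "AE z in M. fst z = 0" by (subst (asm) AE_distr_iff) auto
    then have "(\<integral>\<^sup>+z. ennreal (\<bar>fst z - snd z\<bar>\<^sup>2) \<partial>M) = (\<integral>\<^sup>+z. ennreal ((snd z)\<^sup>2) \<partial>M)"
      by (intro nn_integral_cong_AE) (auto elim!: eventually_mono)
    also have "\<dots> = (\<integral>\<^sup>+y. ennreal (y\<^sup>2) \<partial>distr M borel snd)" by (subst nn_integral_distr) auto
    finally show ?thesis by (simp add: d m)
  qed
  \<comment> \<open>Some coupling has to exist, since the infimum over the empty set would be
    infinite.\<close>
  have "coupling (return borel 0) \<nu> (distr \<nu> (borel \<Otimes>\<^sub>M borel) (\<lambda>y. (0, y)))"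
  proof -
    interpret prob_space \<nu> by fact
    have [measurable]: "(\<lambda>y. (0, y)) \<in> \<nu> \<rightarrow>\<^sub>M borel \<Otimes>\<^sub>M borel" by measurable
    have "distr \<nu> borel (\<lambda>y. 0) = return borel (0 :: real)"
      by (rule measure_eqI) (auto simp: emeasure_distr emeasure_space_1 indicator_def vimage_def)
    moreover have "distr \<nu> borel (\<lambda>y. y) = \<nu>" by (rule distr_id2) (simp add: meas)
    ultimately show ?thesis
      by (auto simp: coupling_def distr_distr comp_def intro!: prob_space_distr)
  qed
  then have "(INF M \<in> {M. coupling (return borel 0) \<nu> M}. \<integral>\<^sup>+z. ennreal (\<bar>fst z - snd z\<bar>\<^sup>2) \<partial>M) = ennreal m"
    using cost by (intro INF_eq_const) auto
  then show ?thesis using m(2) by (simp add: wasserstein2_def)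
qed

lemma W2_gaussian:
  assumes "\<theta> \<in> gaussian_params"
  shows "W2 (return borel 0) gaussian \<theta> = ennreal (norm \<theta>)"
proof -
  define m s where "m = \<theta> $ 1" and "s = \<theta> $ 2"
  have s: "s > 0" using assms by (simp add: gaussian_params_def s_def)
  \<comment> \<open>Expanding x^2 about the mean as (x - m)^2 + 2 m (x - m) + m^2 reduces the second
    moment to the central moments s^2, 0 and 1.\<close>
  have "has_bochner_integral lborel (\<lambda>x. normal_density m s x * (x - m)\<^sup>2
      + 2 * m * (normal_density m s x * (x - m)) + m\<^sup>2 * normal_density m s x) (s\<^sup>2 + 2 * m * 0 + m\<^sup>2 * 1)"
    using normal_moment_even[OF s, of m 1] normal_moment_odd[OF s, of m 0] normal_moment_even[OF s, of m 0] s
    by (intro has_bochner_integral_add has_bochner_integral_mult_right) (auto simp: power2_eq_square field_simps)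
  moreover have "(\<lambda>x. normal_density m s x * (x - m)\<^sup>2
      + 2 * m * (normal_density m s x * (x - m)) + m\<^sup>2 * normal_density m s x) = (\<lambda>x. normal_density m s x * x\<^sup>2)"
    by (auto simp: power2_eq_square algebra_simps)
  ultimately have "has_bochner_integral lborel (\<lambda>x. normal_density m s x * x\<^sup>2) (m\<^sup>2 + s\<^sup>2)"
    by (simp add: add.commute)
  then have "(\<integral>\<^sup>+x. ennreal (normal_density m s x * x\<^sup>2) \<partial>lborel) = ennreal (m\<^sup>2 + s\<^sup>2)"
    by (subst nn_integral_eq_integral) (auto simp: has_bochner_integral_iff)
  then have "(\<integral>\<^sup>+x. ennreal (x\<^sup>2) \<partial>gaussian \<theta>) = ennreal (m\<^sup>2 + s\<^sup>2)"
    by (simp add: gaussian_def nn_integral_density ennreal_mult m_def s_def)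
  moreover have "prob_space (gaussian \<theta>)"
    using prob_space_normal_density[OF s] by (simp add: gaussian_def m_def s_def)
  ultimately have "wasserstein2 (return borel 0) (gaussian \<theta>) = ennreal (sqrt (m\<^sup>2 + s\<^sup>2))"
    by (intro wasserstein2_return_0) (auto simp: gaussian_def)
  then show ?thesis by (simp add: W2_def norm_vec_2 m_def s_def)
qed

lemma W2_ext_gaussian:
  "x \<in> ext_closure gaussian_params \<Longrightarrow> W2_ext gaussian_params (return borel 0) gaussian x = norm_ext x"
  by (rule W2_ext_eqI[OF continuous_on_norm_ext]) (auto simp: W2_gaussian)

lemma W2_sup_gaussian: "W2_sup gaussian_params (return borel 0) gaussian = \<infinity>"
proof (rule ccontr)
  assume "W2_sup gaussian_params (return borel 0) gaussian \<noteq> \<infinity>"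
  then obtain s where s: "W2_sup gaussian_params (return borel 0) gaussian = ennreal s" "s \<ge> 0"
    by (cases "W2_sup gaussian_params (return borel 0) gaussian" rule: ennreal_cases) auto
  \<comment> \<open>The point (0, s + 1), whose norm exceeds the supposed bound s.\<close>
  let ?\<theta> = "polar (s + 1) (pi / 2)"
  have "?\<theta> \<in> gaussian_params" using s by (simp add: gaussian_params_def)
  then have "W2 (return borel 0) gaussian ?\<theta> \<le> ennreal s"
    unfolding s(1)[symmetric] W2_sup_def by (rule SUP_upper)
  then show False using s W2_gaussian[OF \<open>?\<theta> \<in> _\<close>] by simp
qed

lemma level_set_gaussian:
  "level_set gaussian_params (return borel 0) gaussian w = {x \<in> ext_closure gaussian_params. norm_ext x = w}"
  by (auto simp: level_set_def W2_ext_gaussian)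

text \<open>The gradient of the norm is the unit radial vector \<open>sgn \<theta>\<close>,
  continuous and nonzero because \<open>\<sigma> > 0\<close>. Level sets are closed in a compact
  space, and finite levels contain no infinite point.\<close>

lemma wcp2_admissible_gaussian: "wcp2_admissible gaussian_params (return borel 0) gaussian"
proof -
  let ?W = "W2 (return borel 0) gaussian"
  have nz: "\<theta> \<noteq> 0" if "\<theta> \<in> gaussian_params" for \<theta> using that by (auto simp: gaussian_params_def)
  have "((\<lambda>t. enn2real (?W t)) has_derivative (\<lambda>h. sgn \<theta> \<bullet> h)) (at \<theta> within gaussian_params)"
    if \<theta>: "\<theta> \<in> gaussian_params" for \<theta>
  proof (rule has_derivative_transform[OF \<theta>])
    show "(norm has_derivative (\<lambda>h. sgn \<theta> \<bullet> h)) (at \<theta> within gaussian_params)"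
      using has_derivative_at_withinI[OF has_derivative_norm[OF nz[OF \<theta>]]] by (simp add: inner_commute)
  qed (simp add: W2_gaussian)
  moreover have "continuous_on gaussian_params (sgn :: real ^ 2 \<Rightarrow> _)"
    using nz by (intro continuous_on_sgn continuous_intros) auto
  ultimately have "\<exists>g :: real ^ 2 \<Rightarrow> real ^ 2. continuous_on gaussian_params g \<and>
      (\<forall>\<theta>\<in>gaussian_params. ((\<lambda>t. enn2real (?W t)) has_derivative (\<lambda>h. g \<theta> \<bullet> h)) (at \<theta> within gaussian_params)
         \<and> (gaussian \<theta> \<noteq> return borel 0 \<longrightarrow> g \<theta> \<noteq> 0))"
    using nz by (intro exI[of _ sgn]) (auto simp: sgn_zero_iff)
  moreover have "(?W \<longlongrightarrow> W2_ext gaussian_params (return borel 0) gaussian x) (param_filter gaussian_params x)"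
    if "x \<in> ext_closure gaussian_params" for x
    unfolding W2_ext_gaussian[OF that]
    by (rule filterlim_param_filter[OF continuous_on_norm_ext]) (simp add: W2_gaussian)
  moreover have "continuous_on (ext_closure gaussian_params) (W2_ext gaussian_params (return borel 0) gaussian)"
    using continuous_on_subset[OF continuous_on_norm_ext subset_UNIV]
    by (rule continuous_on_eq) (simp add: W2_ext_gaussian)
  moreover have "compact (level_set gaussian_params (return borel 0) gaussian w)" for w
  proof -
    have "closed {x :: ereal ^ 2. norm_ext x = w}"
      by (intro closed_Collect_eq continuous_on_norm_ext continuous_intros)
    moreover have "closed (ext_closure gaussian_params)" by (simp add: ext_closure_def)
    ultimately have "closed (ext_closure gaussian_params \<inter> {x. norm_ext x = w})" by (rule closed_Int[rotated])
    then have "compact (UNIV \<inter> (ext_closure gaussian_params \<inter> {x. norm_ext x = w}))"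
      by (rule compact_Int_closed[OF compact_UNIV_ereal_2])
    then show ?thesis by (simp add: level_set_gaussian Int_def)
  qed
  moreover have "level_set gaussian_params (return borel 0) gaussian w \<subseteq> range embed" if "w < \<infinity>" for w
  proof
    fix x assume "x \<in> level_set gaussian_params (return borel 0) gaussian w"
    then have "norm_ext x \<noteq> \<infinity>" using that by (auto simp: level_set_gaussian)
    then show "x \<in> range embed" using norm_ext_eq_infinity_iff[of x] by blast
  qed
  ultimately show ?thesis
    unfolding wcp2_admissible_def by (simp add: W2_sup_gaussian W2_gaussian)
qed

section \<open>The prior\<close>

lemma trunc_exponential_infinity:
  "trunc_exponential \<eta> \<infinity> = density lborel (\<lambda>w. if 0 < w then ennreal (\<eta> * exp (- \<eta> * w)) else 0)"
  unfolding trunc_exponential_def by (intro arg_cong[of _ _ "density lborel"] ext) simp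

lemma sets_trunc_exponential [simp, measurable_cong]: "sets (trunc_exponential \<eta> c) = sets borel"
  and space_trunc_exponential [simp]: "space (trunc_exponential \<eta> c) = UNIV"
  by (simp_all add: trunc_exponential_def)

lemma prob_space_trunc_exponential_infinity:
  assumes "\<eta> > 0"
  shows "prob_space (trunc_exponential \<eta> \<infinity>)"
proof -
  have "trunc_exponential \<eta> \<infinity> = density lborel (exponential_density \<eta>)"
    unfolding trunc_exponential_infinity
  proof (rule density_cong)
    \<comment> \<open>The two densities differ only at w = 0, where the library density is
      positive.\<close>
    show "AE w in lborel. (if 0 < w then ennreal (\<eta> * exp (- \<eta> * w)) else 0) = ennreal (exponential_density \<eta> w)"
      using AE_lborel_singleton[of "0::real"]
      by eventually_elim (auto simp: exponential_density_def mult.commute)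
  qed auto
  then show ?thesis using prob_space_exponential_density[OF assms] by simp
qed

text \<open>Nonnegativity of \<open>r\<close> is essential: \<open>ennreal\<close> sends a negative
  number to 0, whose level is the origin and not empty.\<close>

lemma vimage_level_set_gaussian:
  assumes "r \<ge> 0"
  shows "embed -` level_set gaussian_params (return borel 0) gaussian (ennreal r) = {x. x $ 2 \<ge> 0 \<and> norm x = r}"
  using assms by (auto simp: level_set_gaussian ext_closure_gaussian_params(2))

text \<open>Writes the mixture of uniform laws as an integral over radius and angle, the form that
  the claimed density takes in polar coordinates.\<close>

lemma nn_integral_uniform_surface:
  assumes A: "A \<in> sets borel" and B: "B \<in> sets borel"
  shows "(\<integral>\<^sup>+w. uniform_surface (embed -` level_set gaussian_params (return borel 0) gaussian (ennreal w)) A * indicator B (ennreal w)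
      \<partial>trunc_exponential \<eta> \<infinity>)
    = (\<integral>\<^sup>+w\<in>{0<..}. ennreal (\<eta> * exp (- \<eta> * w)) * (emeasure lborel {t \<in> {0<..<pi}. polar w t \<in> A} / ennreal pi) * indicator B (ennreal w) \<partial>lborel)"
    (is "?L = ?R")
proof -
  note [measurable] = A B
  \<comment> \<open>As an inner integral of a jointly measurable function, the angular measure is
    visibly measurable in the radius.\<close>
  define I where "I w = (\<integral>\<^sup>+t\<in>{0<..<pi}. indicator A (polar w t) \<partial>lborel)" for w
  have I: "emeasure lborel {t \<in> {0<..<pi}. polar w t \<in> A} = I w" for w
  proof -
    have [measurable]: "polar w \<in> borel_measurable borel"
      by (intro borel_measurable_continuous_onI continuous_intros)
    have "I w = (\<integral>\<^sup>+t. indicator {t \<in> {0<..<pi}. polar w t \<in> A} t \<partial>lborel)"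
      unfolding I_def by (intro nn_integral_cong) (auto simp: indicator_def)
    also have "\<dots> = emeasure lborel {t \<in> {0<..<pi}. polar w t \<in> A}"
      by (rule nn_integral_indicator) simp
    finally show ?thesis by simp
  qed
  have [measurable]: "I \<in> borel_measurable borel" unfolding I_def by measurable
  \<comment> \<open>The half circle formula holds for positive radii only, and these carry all the
    mass.\<close>
  have "AE w in trunc_exponential \<eta> \<infinity>. w > 0"
    unfolding trunc_exponential_infinity by (subst AE_density) (auto split: if_splits)
  then have "?L = (\<integral>\<^sup>+w. I w / ennreal pi * indicator B (ennreal w) \<partial>trunc_exponential \<eta> \<infinity>)"
    by (intro nn_integral_cong_AE, eventually_elim)
      (simp add: vimage_level_set_gaussian uniform_surface_upper_semicircle A flip: I)
  also have "\<dots> = (\<integral>\<^sup>+w. (if 0 < w then ennreal (\<eta> * exp (- \<eta> * w)) else 0) * (I w / ennreal pi * indicator B (ennreal w)) \<partial>lborel)"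
    unfolding trunc_exponential_infinity by (subst nn_integral_density) auto
  also have "\<dots> = ?R"
    unfolding I by (intro nn_integral_cong) (auto simp: mult_ac)
  finally show ?thesis .
qed

definition gaussian_wcp2 :: "real \<Rightarrow> (real ^ 2) measure" where
  "gaussian_wcp2 \<eta> = density lborel (\<lambda>\<theta>.
      if \<theta> \<in> gaussian_params
      then ennreal (\<eta> * exp (- \<eta> * sqrt ((\<theta> $ 1)\<^sup>2 + (\<theta> $ 2)\<^sup>2)) / (pi * sqrt ((\<theta> $ 1)\<^sup>2 + (\<theta> $ 2)\<^sup>2)))
      else 0)"

lemma gaussian_params_borel [measurable]: "gaussian_params \<in> sets borel"
  unfolding gaussian_params_def by measurable

text \<open>The Jacobian r cancels the factor 1 / r of the density. What remains is the exponential
  density in r times the constant 1 / pi in the angle, with \<open>B\<close> restricting r and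
  \<open>A\<close> the point.\<close>

lemma emeasure_gaussian_wcp2:
  assumes "\<eta> > 0" and A: "A \<in> sets borel" and B: "B \<in> sets borel"
  shows "emeasure (gaussian_wcp2 \<eta>) {\<theta> \<in> A. \<theta> $ 2 \<ge> 0 \<and> ennreal (norm \<theta>) \<in> B}
    = (\<integral>\<^sup>+w. uniform_surface (embed -` level_set gaussian_params (return borel 0) gaussian (ennreal w)) A * indicator B (ennreal w)
      \<partial>trunc_exponential \<eta> \<infinity>)"
proof -
  note [measurable] = A B
  let ?p = "\<lambda>\<theta> :: real ^ 2. \<eta> * exp (- \<eta> * norm \<theta>) / (pi * norm \<theta>)"
  have "emeasure (gaussian_wcp2 \<eta>) {\<theta> \<in> A. \<theta> $ 2 \<ge> 0 \<and> ennreal (norm \<theta>) \<in> B}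
      = (\<integral>\<^sup>+\<theta>\<in>{\<theta> :: real ^ 2. \<theta> $ 2 > 0}. ennreal (?p \<theta>) * (indicator A \<theta> * indicator B (ennreal (norm \<theta>))) \<partial>lborel)"
  proof -
    have [measurable]: "{\<theta> \<in> A. \<theta> $ 2 \<ge> 0 \<and> ennreal (norm \<theta>) \<in> B} \<in> sets borel" by measurable
    show ?thesis
      unfolding gaussian_wcp2_def norm_vec_2[symmetric]
      by (subst emeasure_density) (auto simp: indicator_def gaussian_params_def intro!: nn_integral_cong)
  qed
  also have "\<dots> = (\<integral>\<^sup>+r\<in>{0<..}. (\<integral>\<^sup>+t\<in>{0<..<pi}. ennreal r * (ennreal (?p (polar r t))
      * (indicator A (polar r t) * indicator B (ennreal (norm (polar r t))))) \<partial>lborel) \<partial>lborel)"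
    by (rule nn_integral_polar) measurable
  also have "\<dots> = (\<integral>\<^sup>+w\<in>{0<..}. ennreal (\<eta> * exp (- \<eta> * w)) * (emeasure lborel {t \<in> {0<..<pi}. polar w t \<in> A} / ennreal pi) * indicator B (ennreal w) \<partial>lborel)"
  proof (intro nn_integral_cong)
    fix r :: real
    show "(\<integral>\<^sup>+t\<in>{0<..<pi}. ennreal r * (ennreal (?p (polar r t))
        * (indicator A (polar r t) * indicator B (ennreal (norm (polar r t))))) \<partial>lborel) * indicator {0<..} r
      = ennreal (\<eta> * exp (- \<eta> * r)) * (emeasure lborel {t \<in> {0<..<pi}. polar r t \<in> A} / ennreal pi)
        * indicator B (ennreal r) * indicator {0<..} r"
    proof (cases "r > 0")
      case True
      have [measurable]: "polar r \<in> borel_measurable borel"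
        by (intro borel_measurable_continuous_onI continuous_intros)
      have c: "ennreal r * ennreal (\<eta> * exp (- \<eta> * r) / (pi * r)) = ennreal (\<eta> * exp (- \<eta> * r)) / ennreal pi"
        using True \<open>\<eta> > 0\<close> by (simp add: ennreal_mult[symmetric] divide_ennreal)
      have "(\<integral>\<^sup>+t\<in>{0<..<pi}. ennreal r * (ennreal (?p (polar r t))
          * (indicator A (polar r t) * indicator B (ennreal (norm (polar r t))))) \<partial>lborel)
        = (\<integral>\<^sup>+t. (ennreal r * ennreal (\<eta> * exp (- \<eta> * r) / (pi * r)) * indicator B (ennreal r))
            * indicator {t \<in> {0<..<pi}. polar r t \<in> A} t \<partial>lborel)"
        using True by (intro nn_integral_cong) (auto simp: indicator_def)
      also have "\<dots> = ennreal (\<eta> * exp (- \<eta> * r)) / ennreal pi * indicator B (ennreal r)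
          * emeasure lborel {t \<in> {0<..<pi}. polar r t \<in> A}"
        unfolding c by (rule nn_integral_cmult_indicator) simp
      finally show ?thesis by (simp add: divide_ennreal_def mult_ac)
    qed simp
  qed
  finally show ?thesis by (simp only: nn_integral_uniform_surface[OF A B])
qed

lemma uniform_surface_level_set_UNIV:
  assumes "w > 0"
  shows "uniform_surface (embed -` level_set gaussian_params (return borel 0) gaussian (ennreal w)) UNIV = 1"
proof -
  have "emeasure lborel {t \<in> {0<..<pi}. polar w t \<in> UNIV} = ennreal pi"
    using emeasure_lborel_Ioo[of 0 pi] by (simp add: greaterThanLessThan_def greaterThan_def lessThan_def Int_def)
  then show ?thesis
    using assms by (simp only: vimage_level_set_gaussian less_imp_le uniform_surface_upper_semicircle sets.top)
      (auto intro!: ennreal_divide_self simp: uniform_surface_upper_semicircle)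
qed

text \<open>The law of the norm is the joint identity with \<open>A = UNIV\<close>, where each
  uniform law contributes mass 1.\<close>

lemma emeasure_gaussian_wcp2_norm:
  assumes "\<eta> > 0" and B: "B \<in> sets borel"
  shows "emeasure (gaussian_wcp2 \<eta>) {\<theta>. \<theta> $ 2 \<ge> 0 \<and> ennreal (norm \<theta>) \<in> B}
    = emeasure (trunc_exponential \<eta> \<infinity>) {w. ennreal w \<in> B}"
proof -
  note [measurable] = B
  have "AE w in trunc_exponential \<eta> \<infinity>. w > 0"
    unfolding trunc_exponential_infinity by (subst AE_density) (auto split: if_splits)
  then have "(\<integral>\<^sup>+w. uniform_surface (embed -` level_set gaussian_params (return borel 0) gaussian (ennreal w)) UNIV * indicator B (ennreal w)
      \<partial>trunc_exponential \<eta> \<infinity>) = (\<integral>\<^sup>+w. indicator {w. ennreal w \<in> B} w \<partial>trunc_exponential \<eta> \<infinity>)"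
    by (intro nn_integral_cong_AE, eventually_elim) (auto simp: uniform_surface_level_set_UNIV indicator_def)
  also have "\<dots> = emeasure (trunc_exponential \<eta> \<infinity>) {w. ennreal w \<in> B}"
    by (intro nn_integral_indicator) simp
  finally show ?thesis using emeasure_gaussian_wcp2[OF \<open>\<eta> > 0\<close> sets.top B, unfolded space_borel] by simp
qed

lemma AE_gaussian_wcp2: "AE \<theta> in gaussian_wcp2 \<eta>. \<theta> $ 2 \<ge> 0"
proof -
  have "(\<lambda>\<theta>. if \<theta> \<in> gaussian_params
      then ennreal (\<eta> * exp (- \<eta> * sqrt ((\<theta> $ 1)\<^sup>2 + (\<theta> $ 2)\<^sup>2)) / (pi * sqrt ((\<theta> $ 1)\<^sup>2 + (\<theta> $ 2)\<^sup>2)))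
      else 0) \<in> borel_measurable lborel" by measurable
  then show ?thesis unfolding gaussian_wcp2_def
    by (subst AE_density) (auto simp: gaussian_params_def split: if_splits)
qed

text \<open>The upper half plane carries all the mass, which by the law of the norm is that of an
  exponential distribution.\<close>

lemma prob_space_gaussian_wcp2:
  assumes "\<eta> > 0"
  shows "prob_space (gaussian_wcp2 \<eta>)"
proof
  have sp: "space (gaussian_wcp2 \<eta>) = UNIV" "sets (gaussian_wcp2 \<eta>) = sets borel" by (simp_all add: gaussian_wcp2_def)
  have "emeasure (gaussian_wcp2 \<eta>) UNIV = emeasure (gaussian_wcp2 \<eta>) {\<theta>. \<theta> $ 2 \<ge> 0}"
    using AE_gaussian_wcp2[of \<eta>] by (intro emeasure_eq_AE) (auto simp: sp)
  also have "\<dots> = emeasure (trunc_exponential \<eta> \<infinity>) UNIV"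
    using emeasure_gaussian_wcp2_norm[OF assms, of UNIV] by simp
  also have "\<dots> = 1"
    using prob_space.emeasure_space_1[OF prob_space_trunc_exponential_infinity[OF assms]]
    by simp
  finally show "emeasure (gaussian_wcp2 \<eta>) (space (gaussian_wcp2 \<eta>)) = 1" by (simp add: sp)
qed

section \<open>Existence and uniqueness of the prior\<close>

theorem proposition6:
  fixes \<eta> :: real and P :: "(real ^ 2) measure"
  assumes "\<eta> > 0"
  shows "wcp2_prior gaussian_params (return borel 0) gaussian \<eta> P \<longleftrightarrow>
    P = density lborel (\<lambda>\<theta>.
      if \<theta> \<in> gaussian_params
      then ennreal (\<eta> * exp (- \<eta> * sqrt ((\<theta> $ 1)\<^sup>2 + (\<theta> $ 2)\<^sup>2)) / (pi * sqrt ((\<theta> $ 1)\<^sup>2 + (\<theta> $ 2)\<^sup>2)))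
      else 0)"
proof -
  let ?D = "gaussian_wcp2 \<eta>"
  have sets_D: "sets ?D = sets borel" by (simp add: gaussian_wcp2_def)
  have set_eq: "{\<theta> \<in> A. embed \<theta> \<in> ext_closure gaussian_params \<and>
      W2_ext gaussian_params (return borel 0) gaussian (embed \<theta>) \<in> B}
    = {\<theta> \<in> A. \<theta> $ 2 \<ge> 0 \<and> ennreal (norm \<theta>) \<in> B}" for A B
    by (auto simp: ext_closure_gaussian_params(2) W2_ext_gaussian)
  \<comment> \<open>Both right-hand sides in the definition of the prior are values of
    \<open>?D\<close>. Being a prior thus means being a probability measure that agrees with
    \<open>?D\<close> on these sets.\<close>
  have prior: "wcp2_prior gaussian_params (return borel 0) gaussian \<eta> Q \<longleftrightarrow>
      prob_space Q \<and> sets Q = sets borel \<and>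
      (\<forall>B \<in> sets borel. emeasure Q {\<theta>. \<theta> $ 2 \<ge> 0 \<and> ennreal (norm \<theta>) \<in> B}
        = emeasure ?D {\<theta>. \<theta> $ 2 \<ge> 0 \<and> ennreal (norm \<theta>) \<in> B}) \<and>
      (\<forall>A \<in> sets borel. \<forall>B \<in> sets borel. emeasure Q {\<theta> \<in> A. \<theta> $ 2 \<ge> 0 \<and> ennreal (norm \<theta>) \<in> B}
        = emeasure ?D {\<theta> \<in> A. \<theta> $ 2 \<ge> 0 \<and> ennreal (norm \<theta>) \<in> B})" for Q
    using wcp2_admissible_gaussian set_eq[of UNIV]
    by (simp add: wcp2_prior_def set_eq W2_sup_gaussian[unfolded infinity_ennreal_def]
        emeasure_gaussian_wcp2_norm[OF assms, unfolded infinity_ennreal_def]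
        emeasure_gaussian_wcp2[OF assms, unfolded infinity_ennreal_def] cong: conj_cong)
  have "P = ?D" if "wcp2_prior gaussian_params (return borel 0) gaussian \<eta> P"
  proof (rule measure_eqI)
    have P: "prob_space P" "sets P = sets borel"
      and P_eq: "\<forall>A \<in> sets borel. \<forall>B \<in> sets borel. emeasure P {\<theta> \<in> A. \<theta> $ 2 \<ge> 0 \<and> ennreal (norm \<theta>) \<in> B}
        = emeasure ?D {\<theta> \<in> A. \<theta> $ 2 \<ge> 0 \<and> ennreal (norm \<theta>) \<in> B}"
      using that unfolding prior by blast+
    then show "sets P = sets ?D" by (simp add: sets_D)
    \<comment> \<open>Taking \<open>B = UNIV\<close> drops the condition on the norm, so
      \<open>P\<close> and \<open>?D\<close> agree on Borel subsets of the closed upper half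
      plane.\<close>
    have eq: "emeasure P {\<theta> \<in> A. \<theta> $ 2 \<ge> 0} = emeasure ?D {\<theta> \<in> A. \<theta> $ 2 \<ge> 0}" if "A \<in> sets borel" for A
      using P_eq[THEN bspec, OF that, THEN bspec, of UNIV] by simp
    have D_eq: "emeasure ?D {\<theta> \<in> A. \<theta> $ 2 \<ge> 0} = emeasure ?D A" if [measurable]: "A \<in> sets borel" for A
      using AE_gaussian_wcp2[of \<eta>] by (intro emeasure_eq_AE) (auto simp: sets_D)
    interpret prob_space P by fact
    have spP: "space P = UNIV" using sets_eq_imp_space_eq[OF P(2)] by simp
    \<comment> \<open>The prior clauses say nothing about the lower half plane. Since
      \<open>P\<close> has total mass 1 and already mass 1 above, nothing is left below.\<close>
    have "emeasure P {\<theta>. \<theta> $ 2 \<ge> 0} = emeasure ?D UNIV"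
      using eq[of UNIV] D_eq[of UNIV] by simp
    also have "\<dots> = 1"
      using prob_space.emeasure_space_1[OF prob_space_gaussian_wcp2[OF assms]] by (simp add: gaussian_wcp2_def)
    finally have "AE \<theta> in P. \<theta> \<in> {\<theta>. \<theta> $ 2 \<ge> 0}"
      by (intro AE_prob_1) (simp add: measure_def)
    then show "emeasure P A = emeasure ?D A" if "A \<in> sets P" for A
    proof -
      have A[measurable]: "A \<in> sets borel" using that P by simp
      have "emeasure P A = emeasure P {\<theta> \<in> A. \<theta> $ 2 \<ge> 0}"
        using \<open>AE \<theta> in P. _\<close> by (intro emeasure_eq_AE) (auto simp: P)
      then show ?thesis by (simp add: eq A D_eq)
    qed
  qed
  moreover have "wcp2_prior gaussian_params (return borel 0) gaussian \<eta> ?D"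
    using prob_space_gaussian_wcp2[OF assms] by (simp add: prior sets_D)
  ultimately show ?thesis unfolding gaussian_wcp2_def[symmetric] by blast
qed

end
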